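(* Let $H$ and $H'$ be ordered graphs with at least one edge each. Then $r_<^m(H,H')<1$ if and only if $H$ and $H'$ are forests and at least one of the following statements holds: (1) $H$ or $H'$ is a partial matching; (2) for one of $H$ or $H'$ each component is a right star, and for the other each vertex has at most one neighbor to its left; (3) for one of $H$ or $H'$ each component is a left star, and for the other each vertex has at most one neighbor to its right; (4) for one of $H$ or $H'$ each component is a left star or a right star, and for the other each component is a monotone path. Moreover, $R_<(H,H')$ contains a partial matching if and only if both $H$ and $H'$ are partial matchings.
   Context: An ordered graph is a finite simple graph together with a linear order of its vertex set; a vertex $u$ is to the left of $v$ if $u<v$. An (ordered) subgraph of an ordered graph inherits the vertex order. A copy of an ordered graph $H$ in an ordered graph $F$ is a subgraph of $F$ isomorphic to $H$ via an order-preserving bijection. For ordered graphs $H,H'$, $R_<(H,H')$ denotes the set of ordered graphs $F$ such that for every coloring of the edges of $F$ in red and blue there is a red copy of $H$ or a blue copy of $H'$. For a graph $G$, its density is $m(G)=\max\{|E(G')|/|V(G')| : G'\subseteq G\}$, and $r_<^m(H,H')=\inf\{m(F): F\in R_<(H,H')\}$. A partial matching is a graph containing no copy of the path $P_3$ on three vertices (i.e., every vertex has degree at most $1$). A right star is an ordered star all of whose leaves are to the right of its center; a left star is an ordered star all of whose leaves are to the left of its center. A monotone path is an ordered path $u_1u_2\cdots u_n$ with $u_1<u_2<\cdots<u_n$. *)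

theory Defs
  imports Complex_Main "HOL-Library.Ramsey" "HOL-Library.Extended_Real"
begin

text \<open>
  The vertex order of an ordered graph is the order of the ambient type. Edges are
  two-element sets of vertices.
\<close>

record 'a ograph =
  verts :: "'a set"
  edges :: "'a set set"

definition ordered_graph :: "'a::linorder ograph \<Rightarrow> bool" where
  "ordered_graph G \<longleftrightarrow> finite (verts G) \<and> edges G \<subseteq> nsets (verts G) 2"

definition subgraph :: "'a::linorder ograph \<Rightarrow> 'a ograph \<Rightarrow> bool" where
  "subgraph G' G \<longleftrightarrow> ordered_graph G' \<and> verts G' \<subseteq> verts G \<and> edges G' \<subseteq> edges G"

definition ordered_iso :: "'a::linorder ograph \<Rightarrow> 'b::linorder ograph \<Rightarrow> bool" where
  "ordered_iso H K \<longleftrightarrow>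
     (\<exists>f. bij_betw f (verts H) (verts K) \<and> strict_mono_on (verts H) f \<and>
          edges K = (\<lambda>e. f ` e) ` edges H)"

definition is_copy :: "'b::linorder ograph \<Rightarrow> 'a::linorder ograph \<Rightarrow> 'b ograph \<Rightarrow> bool" where
  "is_copy C H F \<longleftrightarrow> subgraph C F \<and> ordered_iso H C"

datatype colour = Red | Blue

text \<open>
  Every finite ordered graph is isomorphic to one whose vertices are natural numbers, so
  the Ramsey class is formed over such graphs only. A colouring is a total function on
  sets of vertices; only its values on edges matter.
\<close>

definition ordered_ramsey ::
    "'a::linorder ograph \<Rightarrow> 'b::linorder ograph \<Rightarrow> nat ograph set" where
  "ordered_ramsey H H' =
     {F. ordered_graph F \<and>
         (\<forall>c :: nat set \<Rightarrow> colour.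
            (\<exists>C. is_copy C H F \<and> (\<forall>e \<in> edges C. c e = Red)) \<or>
            (\<exists>C. is_copy C H' F \<and> (\<forall>e \<in> edges C. c e = Blue)))}"

text \<open>
  Subgraphs without vertices are excluded from the maximum. The density of the graph
  without vertices is unspecified; that graph is not in \<open>ordered_ramsey H H'\<close> when \<open>H\<close>
  and \<open>H'\<close> have edges.
\<close>

definition graph_density :: "'a::linorder ograph \<Rightarrow> real" where
  "graph_density G =
     Max {real (card (edges G')) / real (card (verts G')) | G'.
            subgraph G' G \<and> verts G' \<noteq> {}}"

text \<open>
  The infimum is taken in the extended reals, where the empty set has infimum
  \<open>\<infinity>\<close>. By Ramsey's theorem the set is never empty.
\<close>

definition ramsey_density :: "'a::linorder ograph \<Rightarrow> 'b::linorder ograph \<Rightarrow> ereal" where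
  "ramsey_density H H' = (INF F \<in> ordered_ramsey H H'. ereal (graph_density F))"

text \<open>No (unordered) copy \<open>u v w\<close> of the path on three vertices.\<close>

definition partial_matching :: "'a::linorder ograph \<Rightarrow> bool" where
  "partial_matching G \<longleftrightarrow>
     \<not> (\<exists>u v w. u \<noteq> w \<and> {u, v} \<in> edges G \<and> {v, w} \<in> edges G)"

lemma partial_matching_iff_degree_le_1:
  assumes "ordered_graph G"
  shows "partial_matching G \<longleftrightarrow> (\<forall>v \<in> verts G. card {u. {u, v} \<in> edges G} \<le> 1)"
proof -
  have fin: "finite {u. {u, v} \<in> edges G}" for v
    by (rule finite_subset[of _ "verts G"])
      (use assms in \<open>auto simp: ordered_graph_def nsets_def\<close>)
  have deg: "card {u. {u, v} \<in> edges G} \<le> 1 \<longleftrightarrow>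
      (\<forall>u w. {u, v} \<in> edges G \<longrightarrow> {w, v} \<in> edges G \<longrightarrow> u = w)" for v
    using card_le_Suc0_iff_eq[OF fin[of v]] by auto
  have sub: "v \<in> verts G" if "{u, v} \<in> edges G" for u v
    using assms that by (auto simp: ordered_graph_def nsets_def)
  show ?thesis
    unfolding partial_matching_def deg
    using sub by (subst (2) insert_commute) blast
qed

definition is_cycle :: "'a::linorder ograph \<Rightarrow> 'a list \<Rightarrow> bool" where
  "is_cycle G vs \<longleftrightarrow>
     3 \<le> length vs \<and> distinct vs \<and>
     (\<forall>i < length vs. {vs ! i, vs ! (Suc i mod length vs)} \<in> edges G)"

definition forest :: "'a::linorder ograph \<Rightarrow> bool" where
  "forest G \<longleftrightarrow> \<not> (\<exists>vs. is_cycle G vs)"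

definition adj_rel :: "'a::linorder ograph \<Rightarrow> ('a \<times> 'a) set" where
  "adj_rel G = {(u, v). {u, v} \<in> edges G}"

definition induced_subgraph :: "'a::linorder ograph \<Rightarrow> 'a set \<Rightarrow> 'a ograph" where
  "induced_subgraph G W = \<lparr>verts = W, edges = {e \<in> edges G. e \<subseteq> W}\<rparr>"

definition components :: "'a::linorder ograph \<Rightarrow> 'a ograph set" where
  "components G = (\<lambda>u. induced_subgraph G {v. (u, v) \<in> (adj_rel G)\<^sup>*}) ` verts G"

text \<open>A single vertex counts as a (left and right) star and as a monotone path.\<close>

definition right_star :: "'a::linorder ograph \<Rightarrow> bool" where
  "right_star G \<longleftrightarrow>
     (\<exists>c \<in> verts G. edges G = {{c, v} | v. v \<in> verts G - {c}} \<and>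
                    (\<forall>v \<in> verts G - {c}. c < v))"

definition left_star :: "'a::linorder ograph \<Rightarrow> bool" where
  "left_star G \<longleftrightarrow>
     (\<exists>c \<in> verts G. edges G = {{c, v} | v. v \<in> verts G - {c}} \<and>
                    (\<forall>v \<in> verts G - {c}. v < c))"

definition monotone_path :: "'a::linorder ograph \<Rightarrow> bool" where
  "monotone_path G \<longleftrightarrow>
     (\<exists>us. us \<noteq> [] \<and> sorted_wrt (<) us \<and> verts G = set us \<and>
           edges G = {{us ! i, us ! Suc i} | i. Suc i < length us})"

definition left_nbrs :: "'a::linorder ograph \<Rightarrow> 'a \<Rightarrow> 'a set" where
  "left_nbrs G v = {u. {u, v} \<in> edges G \<and> u < v}"

definition right_nbrs :: "'a::linorder ograph \<Rightarrow> 'a \<Rightarrow> 'a set" where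
  "right_nbrs G v = {u. {u, v} \<in> edges G \<and> v < u}"

end

theory Submission
  imports Defs
begin

text \<open>
  A finite graph has density below 1 iff it is a forest, so the question is which pairs have a
  forest in their Ramsey class.

  Root a forest and colour each edge according to the parity of its depth, to the side on which
  the child lies, or to a combination of both. A copy of \<open>H\<close> or \<open>H'\<close> in the respective colour
  class then satisfies a local condition, and the conditions obtained from four colourings combine
  to the cases of the theorem.

  Conversely, if \<open>H\<close> is a partial matching, take one copy of \<open>H'\<close> for every subset of size \<open>|V(H')|\<close> of a
  large interval and apply Ramsey's theorem to the choice of a red edge in each copy. In the
  remaining cases take as vertices all nonempty subsets of a large interval, the parent of a set
  arising by deleting its maximum, together with a mirrored second forest. By Ramsey's theorem the
  colour of an edge depends only on the level in the tree. One red level yields arbitrarily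
  interleaved right stars (left stars in the mirrored forest), while all levels blue yield every
  graph with at most one left (right) neighbour at each vertex.
\<close>

section \<open>Rooted forests and density\<close>

text \<open>Forests are handled through a parent function with decreasing rank: colourings can then
  be defined by recursion along parents, and counting children bounds the number of edges. Each
  colouring yields a clause forbidding an ordered pattern in \<open>H\<close> or in
  \<open>H'\<close>. Four of these clauses together say exactly that all components of one of the
  two graphs are stars; the two clauses about sides then separate the cases. In the constructions,
  homogeneity controls a set only through its size. The towers suit this because an edge is
  determined by its larger set, and because every element beyond a set gives it a child: a vertex
  may receive a child at any later position, which is what allows arbitrary interleaving. The price
  is that many sets share their last element and compete for one position. Hence graphs are first
  placed at positions with ties, and only copies at distinct positions count. A mixture of left and
  right stars needs both towers at once: either each tower used by \<open>H\<close> has a red level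
  and \<open>H\<close> is distributed over them, or one tower used by \<open>H\<close> is blue on
  all low levels and hosts \<open>H'\<close>.\<close>

definition rooted :: "'a::linorder ograph \<Rightarrow> bool" where
  "rooted G \<longleftrightarrow> (\<exists>p rk. \<forall>e \<in> edges G. \<exists>v. e = {v, p v} \<and> rk (p v) < (rk v :: nat))"

lemma ordered_graph_edgeD:
  assumes "ordered_graph G" "{u, v} \<in> edges G"
  shows "u \<in> verts G" "v \<in> verts G" "u \<noteq> v"
proof -
  have "{u, v} \<in> [verts G]\<^bsup>2\<^esup>"
    using assms unfolding ordered_graph_def by blast
  then show "u \<in> verts G" "v \<in> verts G" "u \<noteq> v"
    by simp_all
qed

lemma ordered_graph_edgeE:
  assumes "ordered_graph G" "e \<in> edges G"
  obtains u v where "e = {u, v}" "u < v" "u \<in> verts G" "v \<in> verts G"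
proof -
  have "e \<in> [verts G]\<^bsup>2\<^esup>"
    using assms by (auto simp: ordered_graph_def)
  then obtain x y where "e = {x, y}" "x \<in> verts G" "y \<in> verts G" "x \<noteq> y"
    by (rule nsets2_E)
  then show thesis
    using that[of x y] that[of y x] by (cases x y rule: linorder_cases) (auto simp: insert_commute)
qed

lemma finite_edges: "ordered_graph G \<Longrightarrow> finite (edges G)"
  unfolding ordered_graph_def by (blast intro: finite_subset finite_imp_finite_nsets)

lemma cycle_two_nbrs:
  assumes "is_cycle G vs" "x \<in> set vs"
  obtains y z where "y \<in> set vs" "z \<in> set vs" "y \<noteq> z" "{x, y} \<in> edges G" "{x, z} \<in> edges G"
proof -
  let ?n = "length vs"
  have n: "3 \<le> ?n" and d: "distinct vs"
    and e: "\<And>i. i < ?n \<Longrightarrow> {vs ! i, vs ! (Suc i mod ?n)} \<in> edges G"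
    using assms by (auto simp: is_cycle_def)
  obtain i where i: "i < ?n" "x = vs ! i"
    using assms(2) by (auto simp: in_set_conv_nth)
  define j where "j = (if i = 0 then ?n - 1 else i - 1)"
  define k where "k = (if Suc i = ?n then 0 else Suc i)"
  have j: "j < ?n" "Suc j mod ?n = i"
    using i n by (auto simp: j_def)
  have k: "k < ?n" "Suc i mod ?n = k"
    using i n by (auto simp: k_def)
  have "j \<noteq> k"
    using n i by (auto simp: j_def k_def split: if_splits)
  then have "vs ! j \<noteq> vs ! k"
    using d j k by (simp add: nth_eq_iff_index_eq)
  moreover have "{x, vs ! j} \<in> edges G"
    using e[OF j(1)] j(2) i by (simp add: insert_commute)
  moreover have "{x, vs ! k} \<in> edges G"
    using e[OF i(1)] k(2) i by simp
  ultimately show thesis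
    using that j(1) k(1) by (meson nth_mem)
qed

text \<open>On a cycle, a vertex of maximal rank would have to be the child on both of its cycle
  edges, so its two distinct neighbours would both be its parent.\<close>

lemma rooted_imp_forest:
  assumes "rooted G"
  shows "forest G"
  unfolding forest_def
proof
  assume "\<exists>vs. is_cycle G vs"
  then obtain vs where vs: "is_cycle G vs" by blast
  obtain p rk where pr: "\<And>e. e \<in> edges G \<Longrightarrow> \<exists>v. e = {v, p v} \<and> rk (p v) < (rk v :: nat)"
    using assms by (auto simp: rooted_def)
  have "set vs \<noteq> {}"
    using vs by (auto simp: is_cycle_def)
  then obtain x where x: "x \<in> set vs" "\<And>y. y \<in> set vs \<Longrightarrow> rk y \<le> rk x"
    using Max_in[of "rk ` set vs"] Max_ge[of "rk ` set vs"] by fastforce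
  obtain y z where yz: "y \<in> set vs" "z \<in> set vs" "y \<noteq> z" "{x, y} \<in> edges G" "{x, z} \<in> edges G"
    using cycle_two_nbrs[OF vs x(1)] .
  have parent: "w = p x" if w: "w \<in> set vs" "{x, w} \<in> edges G" for w
  proof -
    obtain v where v: "{x, w} = {v, p v}" "rk (p v) < rk v"
      using pr[OF w(2)] by blast
    then show ?thesis
      using x(2)[OF w(1)] by (auto simp: doubleton_eq_iff)
  qed
  then show False
    using parent[OF yz(1,4)] parent[OF yz(2,5)] yz(3) by blast
qed

text \<open>Take a longest path. All neighbours of its first vertex lie on it, and a neighbour other
  than the second vertex closes a cycle.\<close>

lemma min_degree_two_imp_cycle:
  assumes G: "ordered_graph G" and ne: "verts G \<noteq> {}"
    and deg: "\<And>x. x \<in> verts G \<Longrightarrow> \<exists>y z. y \<noteq> z \<and> {x, y} \<in> edges G \<and> {x, z} \<in> edges G"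
  shows "\<exists>vs. is_cycle G vs"
proof -
  define P where "P xs \<longleftrightarrow> xs \<noteq> [] \<and> distinct xs \<and> set xs \<subseteq> verts G \<and>
    (\<forall>i. Suc i < length xs \<longrightarrow> {xs ! i, xs ! Suc i} \<in> edges G)" for xs
  have fin: "finite (verts G)"
    using G by (simp add: ordered_graph_def)
  obtain r where r: "r \<in> verts G" using ne by blast
  have "P [r]" using r by (simp add: P_def)
  moreover have "\<forall>xs. P xs \<longrightarrow> length xs < Suc (card (verts G))"
    using fin by (auto simp: P_def less_Suc_eq_le distinct_card[symmetric] intro!: card_mono)
  ultimately obtain xs where xs: "P xs" "\<And>ys. P ys \<Longrightarrow> length ys \<le> length xs"
    using ex_has_greatest_nat[of P "[r]" length "Suc (card (verts G))"] by blast
  obtain x zs where xz: "xs = x # zs"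
    using xs(1) by (cases xs) (auto simp: P_def)
  have nb: "y \<in> set xs" if "{x, y} \<in> edges G" for y
  proof (rule ccontr)
    assume "y \<notin> set xs"
    moreover have "{(y # xs) ! i, (y # xs) ! Suc i} \<in> edges G" if "Suc i < length (y # xs)" for i
      using that \<open>{x, y} \<in> edges G\<close> xs(1) xz
      by (cases i) (auto simp: P_def insert_commute)
    ultimately have "P (y # xs)"
      using xs(1) ordered_graph_edgeD[OF G that] by (auto simp: P_def)
    then show False using xs(2) by fastforce
  qed
  have "x \<in> verts G" using xs(1) xz by (auto simp: P_def)
  \<comment> \<open>For a path with a single vertex \<open>xs ! 1\<close> is out of range; avoiding
    this arbitrary value does no harm, since one of two distinct neighbours always differs from
    it.\<close>
  then obtain y where y: "{x, y} \<in> edges G" "y \<noteq> xs ! 1"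
    using deg by metis
  obtain k where k: "k < length xs" "y = xs ! k"
    using nb[OF y(1)] by (auto simp: in_set_conv_nth)
  have "k \<noteq> 0" "k \<noteq> 1"
    using k y xz ordered_graph_edgeD[OF G y(1)] by (auto intro: gr0I)
  then have k2: "2 \<le> k" by simp
  have "is_cycle G (take (Suc k) xs)"
    unfolding is_cycle_def
  proof (intro conjI allI impI)
    show "3 \<le> length (take (Suc k) xs)" using k k2 by simp
    show "distinct (take (Suc k) xs)" using xs(1) by (simp add: P_def)
    fix i assume "i < length (take (Suc k) xs)"
    then have i: "i \<le> k" using k by simp
    have l: "length (take (Suc k) xs) = Suc k" using k by simp
    show "{take (Suc k) xs ! i, take (Suc k) xs ! (Suc i mod length (take (Suc k) xs))} \<in> edges G"
    proof (cases "i = k")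
      case True
      then show ?thesis
        using l k y(1) xz by (simp add: insert_commute[of x] del: take_Suc_Cons)
    next
      case False
      then show ?thesis
        using l k i xs(1) by (auto simp: P_def)
    qed
  qed
  then show ?thesis by blast
qed

text \<open>Delete a vertex \<open>x\<close> of degree at most 1, root the rest, and hang
  \<open>x\<close> below its only neighbour with a rank one higher.\<close>

lemma forest_imp_rooted:
  assumes "ordered_graph G" "forest G"
  shows "rooted G"
  using assms
proof (induction "card (verts G)" arbitrary: G rule: less_induct)
  case less
  note G = less.prems(1) and F = less.prems(2)
  have fin: "finite (verts G)"
    using G by (simp add: ordered_graph_def)
  show ?case
  proof (cases "verts G = {}")
    case True
    then have "edges G = {}"
      using G by (auto elim: ordered_graph_edgeE)
    then show ?thesis by (simp add: rooted_def)
  next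
    case False
    then obtain x where x: "x \<in> verts G"
      and leaf: "\<And>y z. {x, y} \<in> edges G \<Longrightarrow> {x, z} \<in> edges G \<Longrightarrow> y = z"
      using min_degree_two_imp_cycle[OF G False] F unfolding forest_def by metis
    define G' where "G' = induced_subgraph G (verts G - {x})"
    have G': "ordered_graph G'"
      using G by (auto simp: G'_def induced_subgraph_def ordered_graph_def nsets_def)
    have "forest G'"
      using F by (auto simp: forest_def is_cycle_def G'_def induced_subgraph_def)
    moreover have "card (verts G') < card (verts G)"
      using fin x unfolding G'_def induced_subgraph_def ograph.simps by (intro card_Diff1_less)
    ultimately have "rooted G'"
      using less.hyps G' by blast
    then obtain p rk where pr: "\<And>e. e \<in> edges G' \<Longrightarrow> \<exists>v. e = {v, p v} \<and> rk (p v) < (rk v :: nat)"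
      by (auto simp: rooted_def)
    \<comment> \<open>If \<open>x\<close> is isolated, \<open>y\<close> is arbitrary; then no edge
      contains \<open>x\<close> and the new values at \<open>x\<close> are never consulted.\<close>
    define y where "y = (SOME y. {x, y} \<in> edges G)"
    have "\<exists>v. e = {v, (p(x := y)) v} \<and> (rk(x := Suc (rk y))) ((p(x := y)) v) < (rk(x := Suc (rk y))) v"
      if "e \<in> edges G" for e
    proof (cases "x \<in> e")
      case True
      obtain a b where "e = {a, b}"
        using ordered_graph_edgeE[OF G \<open>e \<in> edges G\<close>] by blast
      then have "\<exists>z. e = {x, z}"
        using True by (auto simp: doubleton_eq_iff)
      then obtain z where z: "e = {x, z}" by blast
      then have "{x, y} \<in> edges G"
        unfolding y_def using that by (metis someI)
      then have "y = z" "y \<noteq> x"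
        using leaf that z ordered_graph_edgeD[OF G] by blast+
      then show ?thesis
        using z by (intro exI[of _ x]) auto
    next
      case False
      then have "e \<in> edges G'"
        using that G by (auto simp: G'_def induced_subgraph_def elim!: ordered_graph_edgeE)
      then obtain v where "e = {v, p v}" "rk (p v) < rk v"
        using pr by blast
      then show ?thesis
        using False by (intro exI[of _ v]) auto
    qed
    then show ?thesis
      unfolding rooted_def by blast
  qed
qed

lemma rooted_subgraph: "rooted G \<Longrightarrow> subgraph G' G \<Longrightarrow> rooted G'"
  unfolding rooted_def subgraph_def by (meson subsetD)

text \<open>Sending each edge to its child is injective, because the edge is recovered as the child
  with its parent, and it misses a vertex of least rank.\<close>

lemma rooted_card_edges_less:
  assumes G: "ordered_graph G" and ne: "verts G \<noteq> {}" and "rooted G"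
  shows "card (edges G) < card (verts G)"
proof -
  obtain p rk where pr: "\<forall>e \<in> edges G. \<exists>v. e = {v, p v} \<and> rk (p v) < (rk v :: nat)"
    using \<open>rooted G\<close> by (auto simp: rooted_def)
  obtain ch where ch: "\<And>e. e \<in> edges G \<Longrightarrow> e = {ch e, p (ch e)}"
    "\<And>e. e \<in> edges G \<Longrightarrow> rk (p (ch e)) < rk (ch e)"
    using bchoice[OF pr] by blast
  have fin: "finite (verts G)"
    using G by (simp add: ordered_graph_def)
  then obtain x where x: "x \<in> verts G" "\<And>y. y \<in> verts G \<Longrightarrow> rk x \<le> rk y"
    using Min_in[of "rk ` verts G"] Min_le[of "rk ` verts G"] ne by fastforce
  have "inj_on ch (edges G)"
    by (rule inj_onI) (use ch(1) in metis)
  moreover have "ch ` edges G \<subseteq> verts G - {x}"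
  proof clarify
    fix e assume e: "e \<in> edges G"
    have m: "ch e \<in> verts G" "p (ch e) \<in> verts G"
      using ordered_graph_edgeD[OF G, of "ch e" "p (ch e)"] ch(1)[OF e] e by auto
    have "ch e \<noteq> x"
      using x(2)[OF m(2)] ch(2)[OF e] by auto
    then show "ch e \<in> verts G - {x}" using m by simp
  qed
  ultimately have "card (edges G) \<le> card (verts G - {x})"
    using fin by (metis card_inj_on_le finite_Diff)
  also have "\<dots> < card (verts G)"
    using fin x(1) by (rule card_Diff1_less)
  finally show ?thesis .
qed

section \<open>Cycles and density\<close>

lemma card_cycle_edges:
  assumes "is_cycle G vs"
  shows "card ((\<lambda>i. {vs ! i, vs ! (Suc i mod length vs)}) ` {..<length vs}) = length vs"
proof -
  let ?n = "length vs"
  have n: "3 \<le> ?n" and d: "distinct vs"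
    using assms by (auto simp: is_cycle_def)
  have "inj_on (\<lambda>i. {vs ! i, vs ! (Suc i mod ?n)}) {..<?n}"
  proof (rule inj_onI)
    fix i j assume i: "i \<in> {..<?n}" and j: "j \<in> {..<?n}"
      and eq: "{vs ! i, vs ! (Suc i mod ?n)} = {vs ! j, vs ! (Suc j mod ?n)}"
    have m: "Suc i mod ?n < ?n" "Suc j mod ?n < ?n" using n by (auto intro!: mod_less_divisor)
    have wrap: "Suc k mod ?n = (if Suc k = ?n then 0 else Suc k)" if "k < ?n" for k
      using that by auto
    \<comment> \<open>Two different indices with the same edge would each be the cyclic successor of
      the other, which forces a length of at most 2.\<close>
    show "i = j"
    proof (rule ccontr)
      assume "i \<noteq> j"
      then have "i = Suc j mod ?n" "j = Suc i mod ?n"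
        using eq d i j m by (auto simp: doubleton_eq_iff nth_eq_iff_index_eq)
      then have "i = Suc j \<or> (i = 0 \<and> Suc j = ?n)" "j = Suc i \<or> (j = 0 \<and> Suc i = ?n)"
        using i j wrap by (metis lessThan_iff)+
      then show False
        using n by linarith
    qed
  qed
  then show ?thesis
    by (simp add: card_image)
qed

text \<open>A cycle is a subgraph of density exactly 1, while every nonempty subgraph of a forest
  has fewer edges than vertices. The maximum runs over finitely many values, so the strict bound
  survives.\<close>

lemma density_less_1_iff_forest:
  assumes G: "ordered_graph G" and ne: "verts G \<noteq> {}"
  shows "graph_density G < 1 \<longleftrightarrow> forest G"
proof -
  let ?D = "{real (card (edges G')) / real (card (verts G')) | G'. subgraph G' G \<and> verts G' \<noteq> {}}"
  have fin: "finite (verts G)" "finite (edges G)"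
    using G finite_edges by (auto simp: ordered_graph_def)
  have "finite ?D"
  proof (rule finite_subset)
    show "?D \<subseteq> (\<lambda>(E, V). real (card E) / real (card V)) ` (Pow (edges G) \<times> Pow (verts G))"
      by (force simp: subgraph_def image_iff)
    show "finite ((\<lambda>(E, V). real (card E) / real (card V)) ` (Pow (edges G) \<times> Pow (verts G)))"
      using fin by blast
  qed
  moreover have "?D \<noteq> {}"
    using ne G by (auto simp: subgraph_def)
  ultimately have iff: "graph_density G < 1 \<longleftrightarrow> (\<forall>d \<in> ?D. d < 1)"
    unfolding graph_density_def by (rule Max_less_iff)
  show ?thesis
  proof
    assume "forest G"
    then have "rooted G" using G forest_imp_rooted by blast
    have "d < 1" if d: "d \<in> ?D" for d
    proof -
      obtain G' where G': "d = real (card (edges G')) / real (card (verts G'))"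
        "subgraph G' G" "verts G' \<noteq> {}"
        using d by blast
      have "card (edges G') < card (verts G')"
        using G' rooted_subgraph[OF \<open>rooted G\<close>] by (intro rooted_card_edges_less) (auto simp: subgraph_def)
      then show ?thesis using G' by simp
    qed
    then show "graph_density G < 1" unfolding iff by blast
  next
    assume less: "graph_density G < 1"
    show "forest G"
      unfolding forest_def
    proof
      assume "\<exists>vs. is_cycle G vs"
      then obtain vs where vs: "is_cycle G vs" by blast
      define G' where "G' = \<lparr>verts = set vs,
        edges = (\<lambda>i. {vs ! i, vs ! (Suc i mod length vs)}) ` {..<length vs}\<rparr>"
      have l: "3 \<le> length vs" "distinct vs" using vs by (auto simp: is_cycle_def)
      have E: "edges G' \<subseteq> edges G"
        using vs by (auto simp: is_cycle_def G'_def)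
      have m: "Suc i mod length vs < length vs" for i
        using l by (intro mod_less_divisor) linarith
      have V: "set vs \<subseteq> verts G"
      proof
        fix x assume "x \<in> set vs"
        then obtain y where "{x, y} \<in> edges G"
          using cycle_two_nbrs[OF vs] by metis
        then show "x \<in> verts G" using ordered_graph_edgeD[OF G] by blast
      qed
      have "{vs ! i, vs ! (Suc i mod length vs)} \<in> [set vs]\<^bsup>2\<^esup>" if "i < length vs" for i
        using that m[of i] ordered_graph_edgeD(3)[OF G, of "vs ! i" "vs ! (Suc i mod length vs)"] vs
        by (auto simp: is_cycle_def)
      then have "subgraph G' G"
        using E V by (auto simp: subgraph_def ordered_graph_def G'_def)
      moreover have "verts G' \<noteq> {}" using l by (auto simp: G'_def)
      ultimately have "real (card (edges G')) / real (card (verts G')) < 1"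
        using less iff by blast
      moreover have "card (edges G') = length vs"
        using card_cycle_edges[OF vs] by (simp add: G'_def)
      moreover have "card (verts G') = length vs"
        using l by (simp add: G'_def distinct_card)
      ultimately show False using l by (auto split: if_splits)
    qed
  qed
qed

section \<open>Local descriptions of the components\<close>

text \<open>This and the next three conditions forbid small ordered patterns. Unlike statements
  about components, they can be checked in a coloured copy edge by edge.\<close>

definition no_through_vertex :: "'a::linorder ograph \<Rightarrow> bool" where
  "no_through_vertex G \<longleftrightarrow>
     \<not> (\<exists>u v w. {u, v} \<in> edges G \<and> {v, w} \<in> edges G \<and> u < v \<and> v < w)"

text \<open>Without through vertices every path with three edges alternates in direction, and read
  from the appropriate end it is \<open>a < b > c < d\<close>. So the two conditions together leave
  only stars as components.\<close>

definition no_zigzag :: "'a::linorder ograph \<Rightarrow> bool" where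
  "no_zigzag G \<longleftrightarrow>
     \<not> (\<exists>a b c d. {a, b} \<in> edges G \<and> {c, b} \<in> edges G \<and> {c, d} \<in> edges G \<and>
          a < b \<and> c < b \<and> c < d \<and> a \<noteq> c \<and> b \<noteq> d)"

definition left_unique :: "'a::linorder ograph \<Rightarrow> bool" where
  "left_unique G \<longleftrightarrow>
     (\<forall>u v w. {u, v} \<in> edges G \<longrightarrow> {w, v} \<in> edges G \<longrightarrow> u < v \<longrightarrow> w < v \<longrightarrow> u = w)"

definition right_unique :: "'a::linorder ograph \<Rightarrow> bool" where
  "right_unique G \<longleftrightarrow>
     (\<forall>u v w. {u, v} \<in> edges G \<longrightarrow> {w, v} \<in> edges G \<longrightarrow> v < u \<longrightarrow> v < w \<longrightarrow> u = w)"

abbreviation reach :: "'a::linorder ograph \<Rightarrow> 'a \<Rightarrow> 'a set" where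
  "reach G x \<equiv> {v. (x, v) \<in> (adj_rel G)\<^sup>*}"

lemma left_unique_iff_card:
  assumes G: "ordered_graph G"
  shows "left_unique G \<longleftrightarrow> (\<forall>v \<in> verts G. card (left_nbrs G v) \<le> 1)"
proof -
  have "finite (left_nbrs G v)" for v
    by (rule finite_subset[of _ "verts G"])
      (use G ordered_graph_edgeD(1)[OF G] in \<open>auto simp: left_nbrs_def ordered_graph_def\<close>)
  then have "card (left_nbrs G v) \<le> 1 \<longleftrightarrow>
      (\<forall>u w. {u, v} \<in> edges G \<longrightarrow> {w, v} \<in> edges G \<longrightarrow> u < v \<longrightarrow> w < v \<longrightarrow> u = w)" for v
    using card_le_Suc0_iff_eq[of "left_nbrs G v"] by (auto simp: left_nbrs_def)
  then show ?thesis
    unfolding left_unique_def using ordered_graph_edgeD(2)[OF G] by blast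
qed

lemma right_unique_iff_card:
  assumes G: "ordered_graph G"
  shows "right_unique G \<longleftrightarrow> (\<forall>v \<in> verts G. card (right_nbrs G v) \<le> 1)"
proof -
  have "finite (right_nbrs G v)" for v
    by (rule finite_subset[of _ "verts G"])
      (use G ordered_graph_edgeD(1)[OF G] in \<open>auto simp: right_nbrs_def ordered_graph_def\<close>)
  then have "card (right_nbrs G v) \<le> 1 \<longleftrightarrow>
      (\<forall>u w. {u, v} \<in> edges G \<longrightarrow> {w, v} \<in> edges G \<longrightarrow> v < u \<longrightarrow> v < w \<longrightarrow> u = w)" for v
    using card_le_Suc0_iff_eq[of "right_nbrs G v"] by (auto simp: right_nbrs_def)
  then show ?thesis
    unfolding right_unique_def using ordered_graph_edgeD(2)[OF G] by blast
qed

lemma reach_step: "v \<in> reach G x \<Longrightarrow> {v, w} \<in> edges G \<Longrightarrow> w \<in> reach G x"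
  by (auto simp: adj_rel_def intro: rtrancl_into_rtrancl)

lemma reach_subset_verts:
  assumes "ordered_graph G" "x \<in> verts G"
  shows "reach G x \<subseteq> verts G"
proof
  fix v assume "v \<in> reach G x"
  then have "(x, v) \<in> (adj_rel G)\<^sup>*" by simp
  then show "v \<in> verts G"
    by induction (use assms ordered_graph_edgeD in \<open>auto simp: adj_rel_def\<close>)
qed

lemma edge_sym: "{u, v} \<in> edges G \<Longrightarrow> {v, u} \<in> edges G"
  by (simp add: insert_commute)

lemma components_Ball:
  "(\<forall>C \<in> components G. P C) \<longleftrightarrow> (\<forall>x \<in> verts G. P (induced_subgraph G (reach G x)))"
  by (simp add: components_def)

section \<open>Components that are stars\<close>

lemma reach_star:
  assumes x: "x = c \<or> {c, x} \<in> edges G"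
    and leaf: "\<And>v w. {c, v} \<in> edges G \<Longrightarrow> {v, w} \<in> edges G \<Longrightarrow> w = c"
  shows "reach G x = insert c {v. {c, v} \<in> edges G}"
proof
  show "reach G x \<subseteq> insert c {v. {c, v} \<in> edges G}"
  proof
    fix v assume "v \<in> reach G x"
    then have "(x, v) \<in> (adj_rel G)\<^sup>*" by simp
    then show "v \<in> insert c {v. {c, v} \<in> edges G}"
      by induction (use x leaf in \<open>auto simp: adj_rel_def\<close>)
  qed
  have "c \<in> reach G x"
    using x reach_step[where v = x and w = c and x = x and G = G] by (auto simp: insert_commute)
  then show "insert c {v. {c, v} \<in> edges G} \<subseteq> reach G x"
    using reach_step[where v = c and x = x and G = G] by auto
qed

lemma induced_star_edges:
  assumes G: "ordered_graph G"
    and leaf: "\<And>v w. {c, v} \<in> edges G \<Longrightarrow> {v, w} \<in> edges G \<Longrightarrow> w = c"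
  shows "edges (induced_subgraph G (insert c {v. {c, v} \<in> edges G})) =
    {{c, v} | v. v \<in> insert c {v. {c, v} \<in> edges G} - {c}}" (is "?L = ?R")
proof
  show "?L \<subseteq> ?R"
  proof
    fix e assume "e \<in> ?L"
    then have e: "e \<in> edges G" "e \<subseteq> insert c {v. {c, v} \<in> edges G}"
      by (auto simp: induced_subgraph_def)
    obtain u v where uv: "e = {u, v}" "u \<noteq> v"
      using ordered_graph_edgeE[OF G e(1)] by (metis less_irrefl)
    show "e \<in> ?R"
    proof (cases "u = c")
      case False
      then have "v = c" using e uv leaf by blast
      then show ?thesis using e uv by (auto simp: insert_commute)
    qed (use e uv in auto)
  qed
  show "?R \<subseteq> ?L"
    by (auto simp: induced_subgraph_def)
qed

lemma right_star_componentI: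
  assumes G: "ordered_graph G" and x: "x = c \<or> {c, x} \<in> edges G"
    and leaf: "\<And>v w. {c, v} \<in> edges G \<Longrightarrow> {v, w} \<in> edges G \<Longrightarrow> w = c"
    and right: "\<And>v. {c, v} \<in> edges G \<Longrightarrow> c < v"
  shows "right_star (induced_subgraph G (reach G x))"
proof -
  have reach: "reach G x = insert c {v. {c, v} \<in> edges G}"
    using x leaf by (rule reach_star)
  have "verts (induced_subgraph G (reach G x)) = insert c {v. {c, v} \<in> edges G}"
    unfolding reach by (simp add: induced_subgraph_def)
  moreover have "edges (induced_subgraph G (reach G x)) =
      {{c, v} | v. v \<in> insert c {v. {c, v} \<in> edges G} - {c}}"
    unfolding reach using G leaf by (rule induced_star_edges)
  ultimately show ?thesis
    unfolding right_star_def using right by (intro bexI[of _ c]) simp_all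
qed

lemma left_star_componentI:
  assumes G: "ordered_graph G" and x: "x = c \<or> {c, x} \<in> edges G"
    and leaf: "\<And>v w. {c, v} \<in> edges G \<Longrightarrow> {v, w} \<in> edges G \<Longrightarrow> w = c"
    and left: "\<And>v. {c, v} \<in> edges G \<Longrightarrow> v < c"
  shows "left_star (induced_subgraph G (reach G x))"
proof -
  have reach: "reach G x = insert c {v. {c, v} \<in> edges G}"
    using x leaf by (rule reach_star)
  have "verts (induced_subgraph G (reach G x)) = insert c {v. {c, v} \<in> edges G}"
    unfolding reach by (simp add: induced_subgraph_def)
  moreover have "edges (induced_subgraph G (reach G x)) =
      {{c, v} | v. v \<in> insert c {v. {c, v} \<in> edges G} - {c}}"
    unfolding reach using G leaf by (rule induced_star_edges)
  ultimately show ?thesis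
    unfolding left_star_def using left by (intro bexI[of _ c]) simp_all
qed

text \<open>Every edge of the component contains the centre as its left end, which identifies
  \<open>u\<close> as the centre.\<close>

lemma right_star_componentD:
  assumes "right_star (induced_subgraph G (reach G u))" "{u, v} \<in> edges G" "u < v"
  shows "\<And>w. {v, w} \<in> edges G \<Longrightarrow> w = u" "\<And>w. {u, w} \<in> edges G \<Longrightarrow> u < w"
proof -
  obtain c where c: "edges (induced_subgraph G (reach G u)) = {{c, v} | v. v \<in> reach G u - {c}}"
    "\<forall>v \<in> reach G u - {c}. c < v"
    using assms(1) by (auto simp: right_star_def induced_subgraph_def)
  have u: "u \<in> reach G u" by simp
  have v: "v \<in> reach G u" using reach_step[OF u assms(2)] .
  have star: "\<exists>z. {a, b} = {c, z} \<and> c < z" if "a \<in> reach G u" "{a, b} \<in> edges G" for a b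
  proof -
    have "b \<in> reach G u" using reach_step[OF that] .
    then have "{a, b} \<in> edges (induced_subgraph G (reach G u))"
      using that by (simp add: induced_subgraph_def)
    then show ?thesis using c by auto
  qed
  have uc: "u = c"
    using star[OF u assms(2)] assms(3) by (auto simp: doubleton_eq_iff)
  show "w = u" if "{v, w} \<in> edges G" for w
    using star[OF v that] uc assms(3) by (auto simp: doubleton_eq_iff)
  show "u < w" if "{u, w} \<in> edges G" for w
    using star[OF u that] uc by (auto simp: doubleton_eq_iff)
qed

lemma left_star_componentD:
  assumes "left_star (induced_subgraph G (reach G u))" "{u, v} \<in> edges G" "u < v"
  shows "\<And>w. {u, w} \<in> edges G \<Longrightarrow> w = v" "\<And>w. {v, w} \<in> edges G \<Longrightarrow> w < v"
proof -
  obtain c where c: "edges (induced_subgraph G (reach G u)) = {{c, v} | v. v \<in> reach G u - {c}}"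
    "\<forall>v \<in> reach G u - {c}. v < c"
    using assms(1) by (auto simp: left_star_def induced_subgraph_def)
  have u: "u \<in> reach G u" by simp
  have v: "v \<in> reach G u" using reach_step[OF u assms(2)] .
  have star: "\<exists>z. {a, b} = {c, z} \<and> z < c" if "a \<in> reach G u" "{a, b} \<in> edges G" for a b
  proof -
    have "b \<in> reach G u" using reach_step[OF that] .
    then have "{a, b} \<in> edges (induced_subgraph G (reach G u))"
      using that by (simp add: induced_subgraph_def)
    then show ?thesis using c by auto
  qed
  have vc: "v = c"
    using star[OF u assms(2)] assms(3) by (auto simp: doubleton_eq_iff)
  show "w = v" if "{u, w} \<in> edges G" for w
    using star[OF u that] vc assms(3) by (auto simp: doubleton_eq_iff)
  show "w < v" if "{v, w} \<in> edges G" for w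
    using star[OF v that] vc by (auto simp: doubleton_eq_iff)
qed

lemma no_through_vertexD:
  "no_through_vertex G \<Longrightarrow> {u, v} \<in> edges G \<Longrightarrow> {v, w} \<in> edges G \<Longrightarrow> u < v \<Longrightarrow> v < w \<Longrightarrow> False"
  unfolding no_through_vertex_def by blast

lemma left_uniqueD:
  "left_unique G \<Longrightarrow> {u, v} \<in> edges G \<Longrightarrow> {w, v} \<in> edges G \<Longrightarrow> u < v \<Longrightarrow> w < v \<Longrightarrow> u = w"
  unfolding left_unique_def by blast

lemma right_uniqueD:
  "right_unique G \<Longrightarrow> {u, v} \<in> edges G \<Longrightarrow> {w, v} \<in> edges G \<Longrightarrow> v < u \<Longrightarrow> v < w \<Longrightarrow> u = w"
  unfolding right_unique_def by blast

lemma no_zigzagD: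
  "no_zigzag G \<Longrightarrow> {a, b} \<in> edges G \<Longrightarrow> {c, b} \<in> edges G \<Longrightarrow> {c, d} \<in> edges G \<Longrightarrow>
    a < b \<Longrightarrow> c < b \<Longrightarrow> c < d \<Longrightarrow> a = c \<or> b = d"
  unfolding no_zigzag_def by blast

text \<open>For an edge with ends \<open>u < v\<close>, a second neighbour of \<open>v\<close> would
  lie to its right, making \<open>v\<close> a through vertex, or to its left, violating uniqueness.
  So the right end of every edge is a leaf.\<close>

lemma right_star_components_iff:
  assumes G: "ordered_graph G"
  shows "(\<forall>C \<in> components G. right_star C) \<longleftrightarrow> no_through_vertex G \<and> left_unique G"
proof
  assume "\<forall>C \<in> components G. right_star C"
  then have rs: "right_star (induced_subgraph G (reach G x))" if "x \<in> verts G" for x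
    using that by (simp add: components_Ball)
  have leaf: "w = u" if "{u, v} \<in> edges G" "u < v" "{v, w} \<in> edges G" for u v w
    using right_star_componentD(1)[OF rs that(1,2,3)] ordered_graph_edgeD[OF G that(1)] by blast
  have "no_through_vertex G"
    unfolding no_through_vertex_def using leaf by (metis less_asym)
  moreover have "left_unique G"
    unfolding left_unique_def using leaf by (metis insert_commute)
  ultimately show "no_through_vertex G \<and> left_unique G" ..
next
  assume "no_through_vertex G \<and> left_unique G"
  then have nt: "no_through_vertex G" and lu: "left_unique G" by auto
  have leaf: "w = u" if "{u, v} \<in> edges G" "u < v" "{v, w} \<in> edges G" for u v w
  proof (cases "v < w")
    case True
    then show ?thesis using no_through_vertexD[OF nt that(1,3,2)] by blast
  next
    case False
    then have "w < v"
      using ordered_graph_edgeD(3)[OF G that(3)] by simp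
    then show ?thesis
      using left_uniqueD[OF lu, of u v w] that by (simp add: insert_commute)
  qed
  \<comment> \<open>The centre is the left neighbour of \<open>x\<close> if there is one, and
    \<open>x\<close> itself otherwise.\<close>
  have "right_star (induced_subgraph G (reach G x))" if "x \<in> verts G" for x
  proof (cases "\<exists>c. {c, x} \<in> edges G \<and> c < x")
    case True
    then obtain c where c: "{c, x} \<in> edges G" "c < x" by blast
    have right: "c < v" if "{c, v} \<in> edges G" for v
    proof (rule ccontr)
      assume "\<not> c < v"
      then have "v < c" using ordered_graph_edgeD(3)[OF G that] by simp
      then show False
        using no_through_vertexD[OF nt, of v c x] that c by (simp add: insert_commute)
    qed
    show ?thesis
      by (rule right_star_componentI[OF G, of x c]) (use c right leaf in blast)+
  next
    case False
    have right: "x < v" if "{x, v} \<in> edges G" for v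
      using False ordered_graph_edgeD(3)[OF G that] that by (metis insert_commute neqE)
    show ?thesis
      by (rule right_star_componentI[OF G, of x x]) (use right leaf in blast)+
  qed
  then show "\<forall>C \<in> components G. right_star C"
    by (simp add: components_Ball)
qed

lemma left_star_components_iff:
  assumes G: "ordered_graph G"
  shows "(\<forall>C \<in> components G. left_star C) \<longleftrightarrow> no_through_vertex G \<and> right_unique G"
proof
  assume "\<forall>C \<in> components G. left_star C"
  then have ls: "left_star (induced_subgraph G (reach G x))" if "x \<in> verts G" for x
    using that by (simp add: components_Ball)
  have leaf: "w = v" if "{u, v} \<in> edges G" "u < v" "{u, w} \<in> edges G" for u v w
    using left_star_componentD(1)[OF ls that(1,2,3)] ordered_graph_edgeD[OF G that(1)] by blast
  have "no_through_vertex G"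
    unfolding no_through_vertex_def using leaf by (metis insert_commute less_asym)
  moreover have "right_unique G"
    unfolding right_unique_def using leaf by (metis insert_commute)
  ultimately show "no_through_vertex G \<and> right_unique G" ..
next
  assume "no_through_vertex G \<and> right_unique G"
  then have nt: "no_through_vertex G" and ru: "right_unique G" by auto
  have leaf: "w = u" if "{u, v} \<in> edges G" "v < u" "{v, w} \<in> edges G" for u v w
  proof (cases "w < v")
    case True
    then show ?thesis
      using no_through_vertexD[OF nt, of w v u] that by (simp add: insert_commute)
  next
    case False
    then have "v < w"
      using ordered_graph_edgeD(3)[OF G that(3)] by simp
    then show ?thesis
      using right_uniqueD[OF ru, of u v w] that by (simp add: insert_commute)
  qed
  have "left_star (induced_subgraph G (reach G x))" if "x \<in> verts G" for x
  proof (cases "\<exists>c. {c, x} \<in> edges G \<and> x < c")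
    case True
    then obtain c where c: "{c, x} \<in> edges G" "x < c" by blast
    have left: "v < c" if "{c, v} \<in> edges G" for v
    proof (rule ccontr)
      assume "\<not> v < c"
      then have "c < v" using ordered_graph_edgeD(3)[OF G that] by simp
      then show False
        using no_through_vertexD[OF nt, of x c v] that c by (simp add: insert_commute)
    qed
    show ?thesis
      by (rule left_star_componentI[OF G, of x c]) (use c left leaf in blast)+
  next
    case False
    have left: "v < x" if "{x, v} \<in> edges G" for v
      using False ordered_graph_edgeD(3)[OF G that] that by (metis insert_commute neqE)
    show ?thesis
      by (rule left_star_componentI[OF G, of x x]) (use left leaf in blast)+
  qed
  then show "\<forall>C \<in> components G. left_star C"
    by (simp add: components_Ball)
qed

text \<open>Without through vertices all neighbours of a vertex lie on one side (\<open>up\<close>,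
  \<open>down\<close>). Given an edge with ends \<open>u < v\<close>: if \<open>u\<close> has a
  second neighbour, the absence of zigzags makes all neighbours of \<open>u\<close> leaves and
  \<open>u\<close> the centre of a right star; otherwise \<open>v\<close> is the centre of a left
  star.\<close>

lemma star_components_iff:
  assumes G: "ordered_graph G"
  shows "(\<forall>C \<in> components G. left_star C \<or> right_star C) \<longleftrightarrow>
    no_through_vertex G \<and> no_zigzag G"
proof
  assume "\<forall>C \<in> components G. left_star C \<or> right_star C"
  then have "left_star (induced_subgraph G (reach G x)) \<or> right_star (induced_subgraph G (reach G x))"
    if "x \<in> verts G" for x
    using that by (simp add: components_Ball)
  then have star: "((\<forall>w. {u, w} \<in> edges G \<longrightarrow> w = v) \<and> (\<forall>w. {v, w} \<in> edges G \<longrightarrow> w < v)) \<or>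
      ((\<forall>w. {v, w} \<in> edges G \<longrightarrow> w = u) \<and> (\<forall>w. {u, w} \<in> edges G \<longrightarrow> u < w))"
    if "{u, v} \<in> edges G" "u < v" for u v
    using left_star_componentD[OF _ that] right_star_componentD[OF _ that]
      ordered_graph_edgeD(1)[OF G that(1)] by meson
  have "no_through_vertex G"
    unfolding no_through_vertex_def using star by (metis less_asym)
  moreover have "no_zigzag G"
    unfolding no_zigzag_def
  proof clarify
    fix a b c d
    assume "{a, b} \<in> edges G" "{c, b} \<in> edges G" "{c, d} \<in> edges G" "c < b" "a \<noteq> c" "b \<noteq> d"
    then show False
      using star[of c b] edge_sym[of a b] by blast
  qed
  ultimately show "no_through_vertex G \<and> no_zigzag G" ..
next
  assume "no_through_vertex G \<and> no_zigzag G"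
  then have nt: "no_through_vertex G" and nz: "no_zigzag G" by auto
  have up: "u < w" if "{u, v} \<in> edges G" "u < v" "{u, w} \<in> edges G" for u v w
    using no_through_vertexD[OF nt edge_sym[OF that(3)] that(1) _ that(2)]
      ordered_graph_edgeD(3)[OF G that(3)] by (meson neqE)
  have down: "w < v" if "{u, v} \<in> edges G" "u < v" "{v, w} \<in> edges G" for u v w
    using no_through_vertexD[OF nt that(1,3,2)] ordered_graph_edgeD(3)[OF G that(3)]
    by (meson neqE)
  have star: "left_star (induced_subgraph G (reach G x)) \<or> right_star (induced_subgraph G (reach G x))"
    if e: "{u, v} \<in> edges G" "u < v" and x: "x = u \<or> x = v" for u v x
  proof (cases "\<exists>w. {u, w} \<in> edges G \<and> w \<noteq> v")
    case True
    then obtain w where w: "{u, w} \<in> edges G" "w \<noteq> v" by blast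
    have leaf: "b = u" if "{u, a} \<in> edges G" "{a, b} \<in> edges G" for a b
    proof -
      have ua: "u < a" using up[OF e that(1)] .
      have ba: "b < a" using down[OF that(1) ua that(2)] .
      obtain d where "{u, d} \<in> edges G" "d \<noteq> a"
        using e w by metis
      then show ?thesis
        using no_zigzagD[OF nz edge_sym[OF that(2)] that(1) _ ba ua up[OF e]] by blast
    qed
    have "right_star (induced_subgraph G (reach G x))"
      by (rule right_star_componentI[OF G, of x u]) (use x e leaf up in blast)+
    then show ?thesis ..
  next
    case False
    have leaf: "b = v" if "{v, a} \<in> edges G" "{a, b} \<in> edges G" for a b
    proof (cases "a = u")
      case True
      then show ?thesis using False that by blast
    next
      case False
      have av: "a < v" using down[OF e that(1)] .
      have "{a, v} \<in> edges G" using that(1) by (simp add: insert_commute)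
      then have ab: "a < b" using up that(2) av by blast
      show ?thesis
        using no_zigzagD[OF nz e(1) edge_sym[OF that(1)] that(2) e(2) av ab] False by blast
    qed
    have "left_star (induced_subgraph G (reach G x))"
      by (rule left_star_componentI[OF G, of x v]) (use x edge_sym[OF e(1)] e leaf down in blast)+
    then show ?thesis ..
  qed
  have "left_star (induced_subgraph G (reach G x)) \<or> right_star (induced_subgraph G (reach G x))"
    if "x \<in> verts G" for x
  proof (cases "\<exists>y. {x, y} \<in> edges G")
    case True
    then obtain y where y: "{x, y} \<in> edges G" by blast
    show ?thesis
    proof (cases "x < y")
      case True
      then show ?thesis using star[OF y] by blast
    next
      case False
      then have "y < x" using ordered_graph_edgeD(3)[OF G y] by simp
      moreover have "{y, x} \<in> edges G" using y by (simp add: insert_commute)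
      ultimately show ?thesis using star by blast
    qed
  next
    case False
    have "right_star (induced_subgraph G (reach G x))"
      by (rule right_star_componentI[OF G, of x x]) (use False in blast)+
    then show ?thesis ..
  qed
  then show "\<forall>C \<in> components G. left_star C \<or> right_star C"
    by (simp add: components_Ball)
qed

section \<open>Components that are monotone paths\<close>

lemma monotone_path_componentD:
  assumes "monotone_path (induced_subgraph G (reach G x))"
  obtains us where "sorted_wrt (<) us"
    "\<And>u v. u \<in> reach G x \<Longrightarrow> {u, v} \<in> edges G \<Longrightarrow> u < v \<Longrightarrow>
      \<exists>i. Suc i < length us \<and> u = us ! i \<and> v = us ! Suc i"
proof -
  obtain us where us: "sorted_wrt (<) us"
    "edges (induced_subgraph G (reach G x)) = {{us ! i, us ! Suc i} | i. Suc i < length us}"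
    using assms by (auto simp: monotone_path_def)
  have "\<exists>i. Suc i < length us \<and> u = us ! i \<and> v = us ! Suc i"
    if u: "u \<in> reach G x" and e: "{u, v} \<in> edges G" and less: "u < v" for u v
  proof -
    have "v \<in> reach G x" using reach_step[OF u e] .
    then have "{u, v} \<in> edges (induced_subgraph G (reach G x))"
      using u e by (simp add: induced_subgraph_def)
    then obtain i where i: "Suc i < length us" "{u, v} = {us ! i, us ! Suc i}"
      using us(2) by auto
    moreover have "us ! i < us ! Suc i"
      using sorted_wrt_nth_less[OF us(1)] i(1) by simp
    ultimately show ?thesis
      using less by (auto simp: doubleton_eq_iff)
  qed
  then show thesis using that us(1) by blast
qed

lemma monotone_path_components_unique:
  assumes G: "ordered_graph G" and mp: "\<forall>C \<in> components G. monotone_path C"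
  shows "left_unique G" "right_unique G"
proof -
  show "left_unique G"
    unfolding left_unique_def
  proof (intro allI impI)
    fix u v w
    assume *: "{u, v} \<in> edges G" "{w, v} \<in> edges G" "u < v" "w < v"
    have "monotone_path (induced_subgraph G (reach G v))"
      using mp ordered_graph_edgeD(2)[OF G *(1)] by (simp add: components_Ball)
    then obtain us where us: "sorted_wrt (<) us"
      "\<And>a b. a \<in> reach G v \<Longrightarrow> {a, b} \<in> edges G \<Longrightarrow> a < b \<Longrightarrow>
        \<exists>i. Suc i < length us \<and> a = us ! i \<and> b = us ! Suc i"
      by (rule monotone_path_componentD) blast
    have "u \<in> reach G v" "w \<in> reach G v"
      using reach_step[of v v G] edge_sym[OF *(1)] edge_sym[OF *(2)] by auto
    then obtain i j where "Suc i < length us" "u = us ! i" "v = us ! Suc i"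
        "Suc j < length us" "w = us ! j" "v = us ! Suc j"
      using us(2) * by meson
    moreover have "distinct us"
      using us(1) by (simp add: strict_sorted_iff)
    ultimately show "u = w"
      by (simp add: nth_eq_iff_index_eq)
  qed
  show "right_unique G"
    unfolding right_unique_def
  proof (intro allI impI)
    fix u v w
    assume *: "{u, v} \<in> edges G" "{w, v} \<in> edges G" "v < u" "v < w"
    have "monotone_path (induced_subgraph G (reach G v))"
      using mp ordered_graph_edgeD(2)[OF G *(1)] by (simp add: components_Ball)
    then obtain us where us: "sorted_wrt (<) us"
      "\<And>a b. a \<in> reach G v \<Longrightarrow> {a, b} \<in> edges G \<Longrightarrow> a < b \<Longrightarrow>
        \<exists>i. Suc i < length us \<and> a = us ! i \<and> b = us ! Suc i"
      by (rule monotone_path_componentD) blast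
    have "v \<in> reach G v" by simp
    then obtain i j where "Suc i < length us" "v = us ! i" "u = us ! Suc i"
        "Suc j < length us" "v = us ! j" "w = us ! Suc j"
      using us(2) edge_sym[OF *(1)] edge_sym[OF *(2)] *(3,4) by meson
    moreover have "distinct us"
      using us(1) by (simp add: strict_sorted_iff)
    ultimately show "u = w"
      by (simp add: nth_eq_iff_index_eq)
  qed
qed

text \<open>If steps are unique in both directions, a walk that turns round merely retraces its own
  steps, so a connection can be made without turning.\<close>

lemma rtrancl_Un_converse_single_valued:
  assumes sv: "single_valued R" "single_valued (R\<inverse>)" and "(x, y) \<in> (R \<union> R\<inverse>)\<^sup>*"
  shows "(x, y) \<in> R\<^sup>* \<or> (y, x) \<in> R\<^sup>*"
  using assms(3)
proof induction
  case (step y z)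
  have fwd: "(b, c) \<in> R\<^sup>*" if "(a, b) \<in> R" "(a, c) \<in> R\<^sup>*" "a \<noteq> c" for a b c
    using that(2,3,1) by (cases rule: converse_rtranclE) (use sv(1) in \<open>auto dest: single_valuedD\<close>)
  have bwd: "(c, a) \<in> R\<^sup>*" if "(a, b) \<in> R" "(c, b) \<in> R\<^sup>*" "c \<noteq> b" for a b c
    using that(2,3,1) by (cases rule: rtranclE) (use sv(2) in \<open>auto dest: single_valuedD\<close>)
  show ?case
    using step.IH step.hyps(2) fwd[of y z x] bwd[of z y x]
    by (metis UnE converseD r_into_rtrancl rtrancl.rtrancl_into_rtrancl converse_rtrancl_into_rtrancl)
qed simp

text \<open>List a component in increasing order. Two consecutive entries are joined by an ascending
  walk; its first step ends in the component, strictly above the first entry and at most at the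
  second, hence exactly at the second. So consecutive entries are adjacent, and uniqueness of right
  neighbours leaves no other edges.\<close>

lemma monotone_path_components_iff:
  assumes G: "ordered_graph G"
  shows "(\<forall>C \<in> components G. monotone_path C) \<longleftrightarrow> left_unique G \<and> right_unique G"
proof
  assume "left_unique G \<and> right_unique G"
  then have lu: "left_unique G" and ru: "right_unique G" by auto
  define R where "R = {(u, v). {u, v} \<in> edges G \<and> u < v}"
  have adj: "adj_rel G = R \<union> R\<inverse>"
    using ordered_graph_edgeD(3)[OF G]
    by (auto simp: adj_rel_def R_def insert_commute) (meson neqE)
  have sv: "single_valued R" "single_valued (R\<inverse>)"
    by (auto simp: single_valued_def R_def
      intro: right_uniqueD[OF ru edge_sym edge_sym] left_uniqueD[OF lu])
  have le: "u \<le> v" if "(u, v) \<in> R\<^sup>*" for u v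
    using that by induction (auto simp: R_def)
  have next_le: "b \<le> c" if "(a, b) \<in> R" "(a, c) \<in> R\<^sup>*" "a \<noteq> c" for a b c
    using that(2,3,1) by (cases rule: converse_rtranclE) (use sv(1) le in \<open>auto dest: single_valuedD\<close>)
  have "monotone_path (induced_subgraph G (reach G x))" if x: "x \<in> verts G" for x
  proof -
    define us where "us = sorted_list_of_set (reach G x)"
    have fin: "finite (reach G x)"
      using reach_subset_verts[OF G x] G by (auto simp: ordered_graph_def intro: finite_subset)
    have us: "set us = reach G x" "sorted_wrt (<) us" "distinct us"
      using fin by (auto simp: us_def)
    have conn: "(u, v) \<in> R\<^sup>*" if "u \<in> reach G x" "v \<in> reach G x" "u < v" for u v
    proof -
      have "sym ((R \<union> R\<inverse>)\<^sup>*)"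
        by (intro sym_rtrancl) (auto simp: sym_def)
      then have "(u, v) \<in> (R \<union> R\<inverse>)\<^sup>*"
        using that by (auto simp: adj dest: symD intro: rtrancl_trans)
      then have "(u, v) \<in> R\<^sup>* \<or> (v, u) \<in> R\<^sup>*"
        by (rule rtrancl_Un_converse_single_valued[OF sv])
      then show ?thesis using le that(3) by fastforce
    qed
    have consecutive: "(us ! i, us ! Suc i) \<in> R" if i: "Suc i < length us" for i
    proof -
      have less: "us ! i < us ! Suc i"
        using sorted_wrt_nth_less[OF us(2)] i by simp
      have mem: "us ! i \<in> reach G x" "us ! Suc i \<in> reach G x"
        using i us(1) nth_mem[of i us] nth_mem[of "Suc i" us] by auto
      then have "(us ! i, us ! Suc i) \<in> R\<^sup>*"
        using conn less by blast
      then obtain b where b: "(us ! i, b) \<in> R" "(b, us ! Suc i) \<in> R\<^sup>*"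
        using less by (cases rule: converse_rtranclE) auto
      have "b \<in> reach G x"
        using b(1) mem(1) reach_step[of "us ! i" x G b] by (auto simp: R_def)
      then obtain k where k: "k < length us" "b = us ! k"
        using us(1) by (metis in_set_conv_nth)
      have "us ! i < us ! k" "us ! k \<le> us ! Suc i"
        using b le k by (auto simp: R_def)
      moreover have mono: "us ! a \<le> us ! b" if "a \<le> b" "b < length us" for a b
        using sorted_wrt_nth_less[OF us(2), of a b] that by (cases "a = b") auto
      ultimately have "i < k"
        using i by (metis linorder_not_less Suc_lessD)
      then have "us ! Suc i \<le> us ! k"
        using mono k by simp
      then have "b = us ! Suc i"
        using k \<open>us ! k \<le> us ! Suc i\<close> by simp
      then show ?thesis using b by simp
    qed
    have "edges (induced_subgraph G (reach G x)) = {{us ! i, us ! Suc i} | i. Suc i < length us}"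
    proof
      show "edges (induced_subgraph G (reach G x)) \<subseteq> {{us ! i, us ! Suc i} | i. Suc i < length us}"
      proof
        fix e assume "e \<in> edges (induced_subgraph G (reach G x))"
        then have e: "e \<in> edges G" "e \<subseteq> set us"
          using us(1) by (auto simp: induced_subgraph_def)
        obtain u v where uv: "e = {u, v}" "u < v"
          using ordered_graph_edgeE[OF G e(1)] by metis
        obtain i j where ij: "i < length us" "u = us ! i" "j < length us" "v = us ! j"
          using e(2) uv(1) by (auto simp: in_set_conv_nth)
        have "i < j"
          using uv(2) ij sorted_wrt_nth_less[OF us(2), of j i] by (cases i j rule: linorder_cases) auto
        then have "(u, us ! Suc i) \<in> R"
          using consecutive[of i] ij by simp
        moreover have "(u, v) \<in> R"
          using e uv by (simp add: R_def)
        ultimately have "v = us ! Suc i"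
          using sv(1) by (auto dest: single_valuedD)
        then show "e \<in> {{us ! i, us ! Suc i} | i. Suc i < length us}"
          using uv ij \<open>i < j\<close> by auto
      qed
      show "{{us ! i, us ! Suc i} | i. Suc i < length us} \<subseteq> edges (induced_subgraph G (reach G x))"
        using consecutive us(1) by (auto simp: induced_subgraph_def R_def dest: nth_mem)
    qed
    moreover have "us \<noteq> []"
      using us(1) by auto
    ultimately show ?thesis
      unfolding monotone_path_def using us by (intro exI[of _ us]) (simp add: induced_subgraph_def)
  qed
  then show "\<forall>C \<in> components G. monotone_path C"
    by (simp add: components_Ball)
qed (use monotone_path_components_unique[OF G] in blast)

section \<open>Colourings of rooted forests\<close>

text \<open>
  A copy of \<open>H\<close> in a rooted forest with parent function \<open>p\<close> all of whose edges have the colour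
  singled out by \<open>q\<close>. The colour of an edge is read off at its endpoint
  farther from the root.
\<close>

locale coloured_copy =
  fixes p :: "nat \<Rightarrow> nat" and rk :: "nat \<Rightarrow> nat" and q :: "nat \<Rightarrow> bool"
    and H :: "'a::linorder ograph" and f :: "'a \<Rightarrow> nat"
  assumes ordered: "ordered_graph H"
    and mono: "strict_mono_on (verts H) f"
    and edge: "{u, v} \<in> edges H \<Longrightarrow>
      (f v = p (f u) \<and> rk (f v) < rk (f u) \<and> q (f u)) \<or>
      (f u = p (f v) \<and> rk (f u) < rk (f v) \<and> q (f v))"
begin

definition child :: "'a \<Rightarrow> 'a \<Rightarrow> bool" where
  "child u v \<longleftrightarrow> {u, v} \<in> edges H \<and> f v = p (f u) \<and> rk (p (f u)) < rk (f u) \<and> q (f u)"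

lemma child_cases: "{u, v} \<in> edges H \<Longrightarrow> child u v \<or> child v u"
  using edge[of u v] by (auto simp: child_def insert_commute)

lemma f_less_iff:
  assumes "{u, v} \<in> edges H"
  shows "f u < f v \<longleftrightarrow> u < v"
  using assms ordered_graph_edgeD(1,2)[OF ordered assms] mono
  by (meson strict_mono_on_less)

lemma child_unique:
  assumes "child u v" "child u w"
  shows "v = w"
proof -
  have "v \<in> verts H" "w \<in> verts H" "f v = f w"
    using assms ordered_graph_edgeD(2)[OF ordered] by (auto simp: child_def)
  then show ?thesis
    using mono by (metis strict_mono_on_eqD)
qed

text \<open>When parents lie to the left of their children, every left neighbour of a vertex is its
  parent in the copy.\<close>

lemma left_unique_if:
  assumes "\<And>x. rk (p x) < rk x \<Longrightarrow> q x \<Longrightarrow> p x < x"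
  shows "left_unique H"
proof -
  have "child v u" if e: "{u, v} \<in> edges H" "u < v" for u v
  proof (rule ccontr)
    assume "\<not> child v u"
    then have "child u v" using child_cases[OF e(1)] by blast
    then have "f v < f u" using assms[of "f u"] by (auto simp: child_def)
    then show False using f_less_iff[OF e(1)] e(2) by simp
  qed
  then show ?thesis
    unfolding left_unique_def using child_unique by blast
qed

lemma right_unique_if:
  assumes "\<And>x. rk (p x) < rk x \<Longrightarrow> q x \<Longrightarrow> x < p x"
  shows "right_unique H"
proof -
  have "child v u" if e: "{u, v} \<in> edges H" "v < u" for u v
  proof (rule ccontr)
    assume "\<not> child v u"
    then have "child u v" using child_cases[OF e(1)] by blast
    then have "f u < f v" using assms[of "f u"] by (auto simp: child_def)
    then show False using f_less_iff[OF e(1)] e(2) by simp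
  qed
  then show ?thesis
    unfolding right_unique_def using child_unique by blast
qed

text \<open>The middle vertex of a monotone path is either the middle of a chain of two parent
  steps, which \<open>chain\<close> forces to turn, or the common parent of the other two, which
  \<open>siblings\<close> forces onto one side. It cannot be the common child.\<close>

lemma no_through_vertex_if:
  assumes chain: "\<And>x. rk (p x) < rk x \<Longrightarrow> rk (p (p x)) < rk (p x) \<Longrightarrow> q x \<Longrightarrow> q (p x) \<Longrightarrow>
      p x < x \<longleftrightarrow> \<not> p (p x) < p x"
    and siblings: "\<And>x y. rk (p x) < rk x \<Longrightarrow> rk (p y) < rk y \<Longrightarrow> q x \<Longrightarrow> q y \<Longrightarrow> p x = p y \<Longrightarrow>
      p x < x \<longleftrightarrow> p y < y"
  shows "no_through_vertex H"
  unfolding no_through_vertex_def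
proof clarify
  fix u v w
  assume e: "{u, v} \<in> edges H" "{v, w} \<in> edges H" and less: "u < v" "v < w"
  have f: "f u < f v" "f v < f w"
    using f_less_iff e less by auto
  consider "child u v" "child v w" | "child v u" "child w v" | "child u v" "child w v"
    | "child v u" "child v w"
    using child_cases e by blast
  then show False
  proof cases
    case 1
    then show False using chain[of "f u"] f by (auto simp: child_def)
  next
    case 2
    then show False using chain[of "f w"] f by (auto simp: child_def)
  next
    case 3
    then show False using siblings[of "f u" "f w"] f by (auto simp: child_def)
  next
    case 4
    then show False using child_unique less by fastforce
  qed
qed

text \<open>Orient the middle edge of the zigzag from child to parent. The child has spent its only
  parent, so the outer edge at the child leads to a child of it. The resulting chain of two parent
  steps turns, against \<open>chain\<close>.\<close>

lemma no_zigzag_if: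
  assumes chain: "\<And>x. rk (p x) < rk x \<Longrightarrow> rk (p (p x)) < rk (p x) \<Longrightarrow> q x \<Longrightarrow> q (p x) \<Longrightarrow>
      p x < x \<longleftrightarrow> p (p x) < p x"
  shows "no_zigzag H"
  unfolding no_zigzag_def
proof clarify
  fix a b c d
  assume e: "{a, b} \<in> edges H" "{c, b} \<in> edges H" "{c, d} \<in> edges H"
    and less: "a < b" "c < b" "c < d" and ne: "a \<noteq> c" "b \<noteq> d"
  have f: "f a < f b" "f c < f b" "f c < f d"
    using f_less_iff e less by auto
  show False
    using child_cases[OF e(2)]
  proof
    assume cb: "child c b"
    then have "child d c"
      using child_cases[OF e(3)] child_unique ne by blast
    then show False using chain[of "f d"] cb f by (auto simp: child_def)
  next
    assume bc: "child b c"
    then have "child a b"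
      using child_cases[OF e(1)] child_unique ne by blast
    then show False using chain[of "f a"] bc f by (auto simp: child_def)
  qed
qed

lemma edges_empty:
  assumes "\<And>x. \<not> q x"
  shows "edges H = {}"
proof -
  have "e \<notin> edges H" for e
    using edge ordered_graph_edgeE[OF ordered, of e] assms by metis
  then show ?thesis by blast
qed

lemma forest: "forest H"
proof -
  define par where "par v = (SOME w. child v w)" for v
  have "\<exists>v. e = {v, par v} \<and> rk (f (par v)) < rk (f v)" if e: "e \<in> edges H" for e
  proof -
    obtain a b where ab: "e = {a, b}"
      using ordered_graph_edgeE[OF ordered e] by metis
    then obtain u v where uv: "e = {u, v}" "child u v"
      using child_cases[of a b] e insert_commute[of a b "{}"] by metis
    then have "par u = v"
      unfolding par_def using child_unique by blast
    then show ?thesis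
      using uv by (intro exI[of _ u]) (auto simp: child_def)
  qed
  then have "rooted H"
    unfolding rooted_def by (intro exI[of _ par] exI[of _ "\<lambda>v. rk (f v)"]) blast
  then show ?thesis by (rule rooted_imp_forest)
qed

end

section \<open>Colouring a forest in the Ramsey class\<close>

lemma ordered_ramsey_coloured_copy:
  assumes H: "ordered_graph H" and H': "ordered_graph H'"
    and F: "F \<in> ordered_ramsey H H'"
    and pr: "\<And>e. e \<in> edges F \<Longrightarrow> \<exists>v. e = {v, p v} \<and> rk (p v) < (rk v :: nat)"
  shows "(\<exists>f. coloured_copy p rk q H f) \<or> (\<exists>f. coloured_copy p rk (\<lambda>x. \<not> q x) H' f)"
proof -
  \<comment> \<open>The child of an edge is its end of higher rank and hence determined by the edge,
    so exactly the edges whose child satisfies \<open>q\<close> are red.\<close>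
  define c where "c e = (if \<exists>v. e = {v, p v} \<and> rk (p v) < rk v \<and> q v then Red else Blue)" for e
  have c: "c {v, p v} = Red \<longleftrightarrow> q v" if "rk (p v) < rk v" for v
    using that by (auto simp: c_def doubleton_eq_iff)
  have copy: "\<exists>f. coloured_copy p rk q' K f"
    if K: "ordered_graph K" and C: "is_copy C K F" and mc: "\<forall>e \<in> edges C. c e = col"
      and q': "\<And>v. rk (p v) < rk v \<Longrightarrow> c {v, p v} = col \<Longrightarrow> q' v"
    for K :: "'c::linorder ograph" and C col q'
  proof -
    obtain f where f: "strict_mono_on (verts K) f" "edges C = (\<lambda>e. f ` e) ` edges K"
      using C by (auto simp: is_copy_def ordered_iso_def)
    have "coloured_copy p rk q' K f"
    proof
      fix u v assume "{u, v} \<in> edges K"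
      then have e: "{f u, f v} \<in> edges C"
        unfolding f(2) by (intro image_eqI[of _ _ "{u, v}"]) auto
      then have "{f u, f v} \<in> edges F"
        using C by (auto simp: is_copy_def subgraph_def)
      then obtain x where x: "{f u, f v} = {x, p x}" "rk (p x) < rk x"
        using pr by blast
      have "c {f u, f v} = col" using mc e by blast
      then have "q' x" using q'[OF x(2)] x(1) by simp
      then show "(f v = p (f u) \<and> rk (f v) < rk (f u) \<and> q' (f u)) \<or>
          (f u = p (f v) \<and> rk (f u) < rk (f v) \<and> q' (f v))"
        using x by (auto simp: doubleton_eq_iff)
    qed (use K f in auto)
    then show ?thesis by blast
  qed
  have "(\<exists>C. is_copy C H F \<and> (\<forall>e \<in> edges C. c e = Red)) \<or>
      (\<exists>C. is_copy C H' F \<and> (\<forall>e \<in> edges C. c e = Blue))"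
    using F by (simp add: ordered_ramsey_def)
  then show ?thesis
  proof (elim disjE exE conjE)
    fix C assume "is_copy C H F" "\<forall>e \<in> edges C. c e = Red"
    then show ?thesis using copy[OF H] c by blast
  next
    fix C assume "is_copy C H' F" "\<forall>e \<in> edges C. c e = Blue"
    then show ?thesis
      using copy[OF H', of C Blue "\<lambda>x. \<not> q x"] c by (metis colour.distinct(1))
  qed
qed

text \<open>Supplies colourings computed from the root downwards. Where the rank does not drop
  towards the parent, nothing is claimed and the value is arbitrary.\<close>

lemma parent_recursion:
  fixes p :: "'v \<Rightarrow> 'v" and rk :: "'v \<Rightarrow> nat"
  shows "\<exists>q. \<forall>x. rk (p x) < rk x \<longrightarrow> q x = \<Phi> x (q (p x))"
proof -
  define q where "q = wfrec (measure rk) (\<lambda>q x. \<Phi> x (q (p x)))"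
  have "q x = \<Phi> x (q (p x))" if "rk (p x) < rk x" for x
    using that by (subst def_wfrec[OF q_def[THEN eq_reflection]]) (auto simp: cut_apply)
  then show ?thesis by blast
qed

text \<open>The first two clauses come from colouring by the side of the parent, the third from the
  parity of the depth, the fourth from parity combined with side, and the last two from one
  asymmetric recursive colouring and its complement.\<close>

lemma ordered_ramsey_forest_colourings:
  assumes H: "ordered_graph H" and H': "ordered_graph H'"
    and F: "F \<in> ordered_ramsey H H'" "forest F"
  shows "left_unique H \<or> right_unique H'"
    and "right_unique H \<or> left_unique H'"
    and "no_zigzag H \<or> no_zigzag H'"
    and "no_through_vertex H \<or> no_through_vertex H'"
    and "no_through_vertex H \<or> no_zigzag H'"
    and "no_zigzag H \<or> no_through_vertex H'"
proof -
  have "rooted F"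
    using F forest_imp_rooted by (auto simp: ordered_ramsey_def)
  then obtain p rk where pr: "\<And>e. e \<in> edges F \<Longrightarrow> \<exists>v. e = {v, p v} \<and> rk (p v) < (rk v :: nat)"
    by (auto simp: rooted_def)
  have copy: "(\<exists>f. coloured_copy p rk q H f) \<or> (\<exists>f. coloured_copy p rk (\<lambda>x. \<not> q x) H' f)" for q
    using H H' F(1) pr by (rule ordered_ramsey_coloured_copy)
  have prne: "p x \<noteq> x" if "rk (p x) < rk x" for x
    using that by auto
  show "left_unique H \<or> right_unique H'"
    using copy[of "\<lambda>x. p x < x"]
  proof (elim disjE exE)
    fix f assume "coloured_copy p rk (\<lambda>x. p x < x) H f"
    then have "left_unique H"
      by (rule coloured_copy.left_unique_if)
    then show ?thesis ..
  next
    fix f assume "coloured_copy p rk (\<lambda>x. \<not> p x < x) H' f"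
    then have "right_unique H'"
      by (rule coloured_copy.right_unique_if) (use prne neqE in blast)
    then show ?thesis ..
  qed
  show "right_unique H \<or> left_unique H'"
    using copy[of "\<lambda>x. x < p x"]
  proof (elim disjE exE)
    fix f assume "coloured_copy p rk (\<lambda>x. x < p x) H f"
    then have "right_unique H"
      by (rule coloured_copy.right_unique_if)
    then show ?thesis ..
  next
    fix f assume "coloured_copy p rk (\<lambda>x. \<not> x < p x) H' f"
    then have "left_unique H'"
      by (rule coloured_copy.left_unique_if) (use prne neqE in blast)
    then show ?thesis ..
  qed
  \<comment> \<open>The parity of the depth alternates along parents, so a monochromatic copy
    contains no chain of two parent steps.\<close>
  obtain par where par: "\<And>x. rk (p x) < rk x \<Longrightarrow> par x = (\<not> par (p x))"
    using parent_recursion[of rk p "\<lambda>x b. \<not> b"] by auto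
  show "no_zigzag H \<or> no_zigzag H'"
    using copy[of par]
  proof (elim disjE exE)
    fix f assume "coloured_copy p rk par H f"
    then have "no_zigzag H"
      by (rule coloured_copy.no_zigzag_if) (use par in auto)
    then show ?thesis ..
  next
    fix f assume "coloured_copy p rk (\<lambda>x. \<not> par x) H' f"
    then have "no_zigzag H'"
      by (rule coloured_copy.no_zigzag_if) (use par in auto)
    then show ?thesis ..
  qed
  \<comment> \<open>Siblings have equal parity, so those of one colour lie on the same side of their
    parent; parity changes along a chain, so a chain of one colour turns.\<close>
  show "no_through_vertex H \<or> no_through_vertex H'"
    using copy[of "\<lambda>x. par x = (p x < x)"]
  proof (elim disjE exE)
    fix f assume "coloured_copy p rk (\<lambda>x. par x = (p x < x)) H f"
    then have "no_through_vertex H"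
      by (rule coloured_copy.no_through_vertex_if) (use par in metis)+
    then show ?thesis ..
  next
    fix f assume "coloured_copy p rk (\<lambda>x. par x \<noteq> (p x < x)) H' f"
    then have "no_through_vertex H'"
      by (rule coloured_copy.no_through_vertex_if) (use par in metis)+
    then show ?thesis ..
  qed
  \<comment> \<open>Chosen are the edges at which the direction turns, unless the edge above is
    already chosen. Chosen edges never form a chain, and chosen siblings lie on one side since they
    all turn away from the same direction. Two consecutive edges that are not chosen do not turn. At
    a root, the direction compared with is arbitrary but the same for all its children.\<close>
  obtain q where q: "\<And>x. rk (p x) < rk x \<Longrightarrow> q x = (\<not> q (p x) \<and> (p x < x) \<noteq> (p (p x) < p x))"
    using parent_recursion[of rk p "\<lambda>x b. \<not> b \<and> (p x < x) \<noteq> (p (p x) < p x)"] by auto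
  show "no_through_vertex H \<or> no_zigzag H'"
    using copy[of q]
  proof (elim disjE exE)
    fix f assume "coloured_copy p rk q H f"
    then have "no_through_vertex H"
      by (rule coloured_copy.no_through_vertex_if) (use q in metis)+
    then show ?thesis ..
  next
    fix f assume "coloured_copy p rk (\<lambda>x. \<not> q x) H' f"
    then have "no_zigzag H'"
      by (rule coloured_copy.no_zigzag_if) (use q in metis)
    then show ?thesis ..
  qed
  show "no_zigzag H \<or> no_through_vertex H'"
    using copy[of "\<lambda>x. \<not> q x"]
  proof (elim disjE exE)
    fix f assume "coloured_copy p rk (\<lambda>x. \<not> q x) H f"
    then have "no_zigzag H"
      by (rule coloured_copy.no_zigzag_if) (use q in metis)
    then show ?thesis ..
  next
    fix f assume "coloured_copy p rk (\<lambda>x. \<not> \<not> q x) H' f"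
    then have "no_through_vertex H'"
      by (rule coloured_copy.no_through_vertex_if) (use q in metis)+
    then show ?thesis ..
  qed
qed

section \<open>Necessity of the conditions\<close>

lemma partial_matchingI:
  assumes "no_through_vertex G" "left_unique G" "right_unique G" "ordered_graph G"
  shows "partial_matching G"
  unfolding partial_matching_def
proof clarify
  fix u v w assume e: "{u, v} \<in> edges G" "{v, w} \<in> edges G" and "u \<noteq> w"
  have ne: "u \<noteq> v" "w \<noteq> v"
    using ordered_graph_edgeD(3)[OF assms(4)] e by auto
  note e' = edge_sym[OF e(1)] edge_sym[OF e(2)]
  consider "u < v" "w < v" | "v < u" "v < w" | "u < v" "v < w" | "w < v" "v < u"
    using ne by (meson neqE)
  then show False
  proof cases
    case 1
    then show False using left_uniqueD[OF assms(2) e(1) e'(2)] \<open>u \<noteq> w\<close> by blast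
  next
    case 2
    then show False using right_uniqueD[OF assms(3) e(1) e'(2)] \<open>u \<noteq> w\<close> by blast
  next
    case 3
    then show False using no_through_vertexD[OF assms(1) e] by blast
  next
    case 4
    then show False using no_through_vertexD[OF assms(1) e'(2,1)] by blast
  qed
qed

text \<open>Writing A for \<open>no_through_vertex\<close>, Z for \<open>no_zigzag\<close>, L and R
  for left and right uniqueness, with a prime for \<open>H'\<close>, the last four clauses are
  equivalent to AZ or A'Z'. By symmetry assume AZ. The first two clauses leave LR, LL', RR' and
  L'R'. The choice LR together with A makes \<open>H\<close> a partial matching; each of the others
  is one of the listed cases.\<close>

lemma ordered_ramsey_forest_necessary:
  assumes H: "ordered_graph H" and H': "ordered_graph H'"
    and F: "F \<in> ordered_ramsey H H'" "forest F"
    and npm: "\<not> partial_matching H" "\<not> partial_matching H'"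
  shows
    "(no_through_vertex H \<and> left_unique H \<and> left_unique H') \<or>
     (no_through_vertex H' \<and> left_unique H' \<and> left_unique H) \<or>
     (no_through_vertex H \<and> right_unique H \<and> right_unique H') \<or>
     (no_through_vertex H' \<and> right_unique H' \<and> right_unique H) \<or>
     (no_through_vertex H \<and> no_zigzag H \<and> left_unique H' \<and> right_unique H') \<or>
     (no_through_vertex H' \<and> no_zigzag H' \<and> left_unique H \<and> right_unique H)"
  using ordered_ramsey_forest_colourings[OF H H' F] partial_matchingI[OF _ _ _ H]
    partial_matchingI[OF _ _ _ H'] npm by blast

text \<open>Constant colourings suffice: a graph with an edge has no copy in the colour that does
  not occur.\<close>

lemma ordered_ramsey_forest_imp_forests:
  assumes H: "ordered_graph H" and H': "ordered_graph H'" and ne: "edges H \<noteq> {}" "edges H' \<noteq> {}"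
    and F: "F \<in> ordered_ramsey H H'" "forest F"
  shows "forest H" "forest H'"
proof -
  have "rooted F"
    using F forest_imp_rooted by (auto simp: ordered_ramsey_def)
  then obtain p rk where pr: "\<And>e. e \<in> edges F \<Longrightarrow> \<exists>v. e = {v, p v} \<and> rk (p v) < (rk v :: nat)"
    by (auto simp: rooted_def)
  have copy: "(\<exists>f. coloured_copy p rk q H f) \<or> (\<exists>f. coloured_copy p rk (\<lambda>x. \<not> q x) H' f)" for q
    using H H' F(1) pr by (rule ordered_ramsey_coloured_copy)
  show "forest H"
    using copy[of "\<lambda>_. True"]
  proof (elim disjE exE)
    fix f assume "coloured_copy p rk (\<lambda>_. True) H f"
    then show ?thesis by (rule coloured_copy.forest)
  next
    fix f assume "coloured_copy p rk (\<lambda>_. \<not> True) H' f"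
    then have "edges H' = {}" by (rule coloured_copy.edges_empty) simp
    then show ?thesis using ne by simp
  qed
  show "forest H'"
    using copy[of "\<lambda>_. False"]
  proof (elim disjE exE)
    fix f assume "coloured_copy p rk (\<lambda>_. False) H f"
    then have "edges H = {}" by (rule coloured_copy.edges_empty) simp
    then show ?thesis using ne by simp
  next
    fix f assume "coloured_copy p rk (\<lambda>_. \<not> False) H' f"
    then show ?thesis by (rule coloured_copy.forest)
  qed
qed

section \<open>Graphs with vertices at positions\<close>

text \<open>
  A graph whose vertices are merely placed at positions, several vertices per position being
  allowed. Copies are required to have their vertices at distinct positions, so that they remain
  copies however the vertices at one position are ordered.
\<close>

definition placed_copy ::
    "('v \<Rightarrow> nat) \<Rightarrow> 'v set \<Rightarrow> 'v set set \<Rightarrow> ('v set \<Rightarrow> colour) \<Rightarrow> colour \<Rightarrow>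
     'a::linorder ograph \<Rightarrow> ('a \<Rightarrow> 'v) \<Rightarrow> bool" where
  "placed_copy pos V E c col H \<phi> \<longleftrightarrow>
     \<phi> ` verts H \<subseteq> V \<and> strict_mono_on (verts H) (pos \<circ> \<phi>) \<and>
     (\<forall>u v. {u, v} \<in> edges H \<longrightarrow> u < v \<longrightarrow> {\<phi> u, \<phi> v} \<in> E \<and> c {\<phi> u, \<phi> v} = col)"

definition placed_ramsey ::
    "('v \<Rightarrow> nat) \<Rightarrow> 'v set \<Rightarrow> 'v set set \<Rightarrow> 'a::linorder ograph \<Rightarrow> 'b::linorder ograph \<Rightarrow> bool" where
  "placed_ramsey pos V E H H' \<longleftrightarrow> finite V \<and> E \<subseteq> [V]\<^bsup>2\<^esup> \<and>
     (\<forall>c. (\<exists>\<phi>. placed_copy pos V E c Red H \<phi>) \<or> (\<exists>\<phi>. placed_copy pos V E c Blue H' \<phi>))"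

lemma position_refining_injection:
  fixes pos :: "'v \<Rightarrow> nat"
  assumes "finite V"
  obtains g :: "'v \<Rightarrow> nat" where "inj_on g V"
    "\<And>u v. u \<in> V \<Longrightarrow> v \<in> V \<Longrightarrow> pos u < pos v \<Longrightarrow> g u < g v"
proof -
  obtain k where k: "bij_betw k V {..<card V}"
    using ex_bij_betw_finite_nat[OF assms] by (auto simp: atLeast0LessThan)
  then have k_less: "k v < card V" if "v \<in> V" for v
    using that by (auto simp: bij_betw_def)
  \<comment> \<open>Lexicographic order: positions are scaled by \<open>card V\<close>, so the
    tie-breaker \<open>k v < card V\<close> never overrides them.\<close>
  define g where "g v = pos v * card V + k v" for v
  have less: "g u < g v" if "u \<in> V" "v \<in> V" "pos u < pos v" for u v
  proof -
    have "g u < Suc (pos u) * card V"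
      using k_less[OF that(1)] by (simp add: g_def)
    also have "\<dots> \<le> pos v * card V"
      using that(3) by (intro mult_le_mono1) simp
    also have "\<dots> \<le> g v" by (simp add: g_def)
    finally show ?thesis .
  qed
  have "inj_on g V"
  proof (rule inj_onI)
    fix u v assume uv: "u \<in> V" "v \<in> V" "g u = g v"
    then have "pos u = pos v"
      using less[of u v] less[of v u] by (metis less_irrefl neqE)
    then have "k u = k v" using uv(3) by (simp add: g_def)
    then show "u = v" using k uv by (auto simp: bij_betw_def dest: inj_onD)
  qed
  then show thesis using that less by blast
qed

text \<open>The colouring is pulled back along \<open>g\<close> before the placed copy is sought.
  Since positions increase strictly on that copy and \<open>g\<close> refines them,
  \<open>g \<circ> \<phi>\<close> preserves the vertex order.\<close>

lemma placed_copy_imp_copy: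
  assumes H: "ordered_graph H" and cp: "placed_copy pos V E (\<lambda>e. c (g ` e)) col H \<phi>"
    and g: "inj_on g V" "\<And>u v. u \<in> V \<Longrightarrow> v \<in> V \<Longrightarrow> pos u < pos v \<Longrightarrow> g u < g v"
    and F: "ordered_graph F" "verts F = g ` V" "edges F = (\<lambda>e. g ` e) ` E"
  shows "\<exists>C. is_copy C H F \<and> (\<forall>e \<in> edges C. c e = col)"
proof -
  define f where "f = g \<circ> \<phi>"
  have \<phi>: "\<phi> v \<in> V" if "v \<in> verts H" for v
    using cp that by (auto simp: placed_copy_def)
  have f: "strict_mono_on (verts H) f"
    using cp g(2) \<phi> by (auto simp: placed_copy_def f_def strict_mono_on_def)
  define C where "C = \<lparr>verts = f ` verts H, edges = (\<lambda>e. f ` e) ` edges H\<rparr>"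
  have edge: "e' \<in> edges F \<and> e' \<in> [f ` verts H]\<^bsup>2\<^esup> \<and> c e' = col" if e': "e' \<in> edges C" for e'
  proof -
    obtain e where e: "e \<in> edges H" "e' = f ` e"
      using e' by (auto simp: C_def)
    obtain u v where uv: "e = {u, v}" "u < v" "u \<in> verts H" "v \<in> verts H"
      using ordered_graph_edgeE[OF H e(1)] .
    have eq: "e' = g ` {\<phi> u, \<phi> v}"
      using e uv by (simp add: f_def)
    have "{\<phi> u, \<phi> v} \<in> E" "c (g ` {\<phi> u, \<phi> v}) = col"
      using cp e uv unfolding placed_copy_def by blast+
    moreover have "f u < f v"
      using f uv by (auto simp: strict_mono_on_def)
    moreover have "e' = {f u, f v}"
      using e uv by simp
    ultimately have "e' \<in> [f ` verts H]\<^bsup>2\<^esup>"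
      using uv by auto
    moreover have "e' \<in> edges F"
      unfolding F(3) eq using \<open>{\<phi> u, \<phi> v} \<in> E\<close> by (rule imageI)
    moreover have "c e' = col"
      unfolding eq by fact
    ultimately show ?thesis by blast
  qed
  have "inj_on f (verts H)"
    using f by (rule strict_mono_on_imp_inj_on)
  then have "bij_betw f (verts H) (verts C)"
    by (simp add: C_def inj_on_imp_bij_betw)
  then have "ordered_iso H C"
    unfolding ordered_iso_def using f by (intro exI[of _ f]) (simp add: C_def)
  moreover have "subgraph C F"
  proof -
    have "finite (verts C)" "verts C \<subseteq> verts F"
      using H \<phi> F(2) by (auto simp: C_def ordered_graph_def f_def)
    moreover have "edges C \<subseteq> [verts C]\<^bsup>2\<^esup>" "edges C \<subseteq> edges F"
      using edge by (auto simp: C_def)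
    ultimately show ?thesis
      by (simp add: subgraph_def ordered_graph_def)
  qed
  ultimately show ?thesis
    using edge by (intro exI[of _ C]) (auto simp: is_copy_def)
qed

lemma placed_ramsey_imp_ordered_ramsey:
  assumes H: "ordered_graph H" and H': "ordered_graph H'"
    and PR: "placed_ramsey pos V E H H'"
  obtains F g where "F \<in> ordered_ramsey H H'" "inj_on g V" "edges F = (\<lambda>e. g ` e) ` E"
proof -
  have V: "finite V" "E \<subseteq> [V]\<^bsup>2\<^esup>"
    using PR by (auto simp: placed_ramsey_def)
  obtain g :: "_ \<Rightarrow> nat" where g: "inj_on g V"
    "\<And>u v. u \<in> V \<Longrightarrow> v \<in> V \<Longrightarrow> pos u < pos v \<Longrightarrow> g u < g v"
    using position_refining_injection[OF V(1), of pos] by blast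
  define F where "F = \<lparr>verts = g ` V, edges = (\<lambda>e. g ` e) ` E\<rparr>"
  have "g ` e \<in> [g ` V]\<^bsup>2\<^esup>" if "e \<in> E" for e
  proof -
    have "e \<in> [V]\<^bsup>2\<^esup>" using V that by blast
    then show ?thesis
      using bij_betw_nsets[of g V "g ` V" 2] g(1) by (auto simp: bij_betw_def)
  qed
  then have F: "ordered_graph F"
    using V by (auto simp: ordered_graph_def F_def)
  have "F \<in> ordered_ramsey H H'"
    unfolding ordered_ramsey_def
  proof (intro CollectI conjI allI F)
    fix c :: "nat set \<Rightarrow> colour"
    have "(\<exists>\<phi>. placed_copy pos V E (\<lambda>e. c (g ` e)) Red H \<phi>) \<or>
        (\<exists>\<phi>. placed_copy pos V E (\<lambda>e. c (g ` e)) Blue H' \<phi>)"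
      using PR unfolding placed_ramsey_def by blast
    then show "(\<exists>C. is_copy C H F \<and> (\<forall>e \<in> edges C. c e = Red)) \<or>
        (\<exists>C. is_copy C H' F \<and> (\<forall>e \<in> edges C. c e = Blue))"
    proof (elim disjE exE)
      fix \<phi> assume "placed_copy pos V E (\<lambda>e. c (g ` e)) Red H \<phi>"
      from placed_copy_imp_copy[OF H this g F] show ?thesis by (simp add: F_def)
    next
      fix \<phi> assume "placed_copy pos V E (\<lambda>e. c (g ` e)) Blue H' \<phi>"
      from placed_copy_imp_copy[OF H' this g F] show ?thesis by (simp add: F_def)
    qed
  qed
  then show thesis
    using that g(1) by (simp add: F_def)
qed

text \<open>Parent and rank are carried over along the injection \<open>g\<close> and its inverse on
  \<open>V\<close>; the order of the vertices does not affect acyclicity.\<close>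

lemma placed_ramsey_imp_forest:
  assumes H: "ordered_graph H" and H': "ordered_graph H'"
    and PR: "placed_ramsey pos V E H H'"
    and root: "\<And>e. e \<in> E \<Longrightarrow> \<exists>v. e = {v, p v} \<and> rk (p v) < (rk v :: nat)"
  shows "\<exists>F \<in> ordered_ramsey H H'. forest F"
proof -
  obtain F g where F: "F \<in> ordered_ramsey H H'" "inj_on g V" "edges F = (\<lambda>e. g ` e) ` E"
    using placed_ramsey_imp_ordered_ramsey[OF H H' PR] .
  define h where "h = inv_into V g"
  have "\<exists>w. e' = {w, g (p (h w))} \<and> rk (h (g (p (h w)))) < rk (h w)" if e': "e' \<in> edges F" for e'
  proof -
    obtain e where e: "e \<in> E" "e' = g ` e"
      using e' F(3) by blast
    then obtain v where v: "e = {v, p v}" "rk (p v) < rk v"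
      using root by blast
    have "v \<in> V" "p v \<in> V"
      using PR e v by (auto simp: placed_ramsey_def)
    then have "h (g v) = v" "h (g (p v)) = p v"
      using F(2) by (auto simp: h_def)
    then show ?thesis
      using e v by (intro exI[of _ "g v"]) auto
  qed
  then have "rooted F"
    unfolding rooted_def by (intro exI[of _ "\<lambda>w. g (p (h w))"] exI[of _ "\<lambda>w. rk (h w)"] ballI)
  then show ?thesis
    using F(1) rooted_imp_forest by blast
qed

lemma placed_ramsey_imp_partial_matching:
  assumes H: "ordered_graph H" and H': "ordered_graph H'"
    and PR: "placed_ramsey pos V E H H'"
    and disj: "\<And>d e. d \<in> E \<Longrightarrow> e \<in> E \<Longrightarrow> d \<inter> e \<noteq> {} \<Longrightarrow> d = e"
  shows "\<exists>F \<in> ordered_ramsey H H'. partial_matching F"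
proof -
  obtain F g where F: "F \<in> ordered_ramsey H H'" "inj_on g V" "edges F = (\<lambda>e. g ` e) ` E"
    using placed_ramsey_imp_ordered_ramsey[OF H H' PR] .
  have G: "ordered_graph F"
    using F(1) by (simp add: ordered_ramsey_def)
  have "partial_matching F"
    unfolding partial_matching_def
  proof clarify
    fix u v w assume uvw: "u \<noteq> w" "{u, v} \<in> edges F" "{v, w} \<in> edges F"
    obtain d where d: "{u, v} = g ` d" "d \<in> E"
      using uvw(2) unfolding F(3) by (rule imageE)
    obtain e where e: "{v, w} = g ` e" "e \<in> E"
      using uvw(3) unfolding F(3) by (rule imageE)
    note de = d e
    have V: "d \<subseteq> V" "e \<subseteq> V"
      using PR de by (auto simp: placed_ramsey_def nsets_def)
    obtain x y where "x \<in> d" "g x = v" "y \<in> e" "g y = v"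
      using d(1) e(1) by (metis image_iff insertI1 insertI2)
    then have "d \<inter> e \<noteq> {}"
      using F(2) V by (metis disjoint_iff inj_onD subsetD)
    then have "{u, v} = {v, w}"
      using disj[OF d(2) e(2)] d(1) e(1) by simp
    then show False
      using uvw(1) by (auto simp: doubleton_eq_iff)
  qed
  then show ?thesis using F(1) by blast
qed

section \<open>Ramsey's theorem for all set sizes up to a bound\<close>

lemma ramsey_finite_colours:
  assumes "finite (Q :: 'c set)"
  shows "\<exists>N. \<forall>(A :: nat set) f. finite A \<and> N \<le> card A \<and> (\<forall>X. f X \<in> Q) \<longrightarrow>
    (\<exists>S q. S \<subseteq> A \<and> card S = m \<and> (\<forall>X \<in> [S]\<^bsup>r\<^esup>. f X = (q :: 'c)))" (is "\<exists>N. \<forall>A f. ?P N A f")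
proof -
  obtain h where h: "bij_betw h Q {..<card Q}"
    using ex_bij_betw_finite_nat[OF assms] by (auto simp: atLeast0LessThan)
  obtain N :: nat where N: "partn_lst {..<N} (replicate (card Q) m) r"
    using ramsey_full by blast
  have "?P N A f" for A f
  proof (intro impI, elim conjE)
    assume A: "finite A" "N \<le> card A" and f: "\<forall>X. f X \<in> Q"
    \<comment> \<open>An injection of the standard set into \<open>A\<close> carries the theorem
      over to \<open>A\<close>; it need not be monotone, since only subsets are coloured.\<close>
    obtain k where k: "inj_on k {..<N}" "k ` {..<N} \<subseteq> A"
      using card_le_inj[of "{..<N}" A] A by auto
    have "(\<lambda>X. h (f (k ` X))) \<in> [{..<N}]\<^bsup>r\<^esup> \<rightarrow> {..<card Q}"
      using f bij_betwE[OF h] by blast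
    then obtain i S where S: "i < card Q" "S \<in> [{..<N}]\<^bsup>m\<^esup>" "(\<lambda>X. h (f (k ` X))) ` [S]\<^bsup>r\<^esup> \<subseteq> {i}"
      using partn_lstE[OF N, of "\<lambda>X. h (f (k ` X))" "card Q"] by auto
    have injS: "inj_on k S"
      using k(1) S(2) by (auto simp: nsets_def intro: inj_on_subset)
    have "f X = inv_into Q h i" if X: "X \<in> [k ` S]\<^bsup>r\<^esup>" for X
    proof -
      obtain Y where Y: "Y \<in> [S]\<^bsup>r\<^esup>" "X = k ` Y"
        using nset_image_obtains[OF X injS] .
      then have "h (f X) = i" using S(3) by auto
      then show ?thesis
        using h f by (auto simp: bij_betw_def)
    qed
    moreover have "k ` S \<subseteq> A" "card (k ` S) = m"
      using k S(2) card_image[OF injS] by (auto simp: nsets_def)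
    ultimately show "\<exists>S q. S \<subseteq> A \<and> card S = m \<and> (\<forall>X \<in> [S]\<^bsup>r\<^esup>. f X = q)"
      by blast
  qed
  then show ?thesis by blast
qed

text \<open>First shrink to a set that is homogeneous for the largest size and still large enough
  for the induction hypothesis. Shrinking further for the smaller sizes preserves that homogeneity.
  Every size has its own colour.\<close>

lemma ramsey_all_sizes:
  assumes "finite (Q :: 'c set)"
  shows "\<exists>N. \<forall>(A :: nat set) f. finite A \<and> N \<le> card A \<and> (\<forall>X. f X \<in> Q) \<longrightarrow>
    (\<exists>S q. S \<subseteq> A \<and> card S = m \<and> (\<forall>r \<le> L. \<forall>X \<in> [S]\<^bsup>r\<^esup>. f X = (q r :: 'c)))"
proof (induction L)
  case 0
  have "\<exists>S q. S \<subseteq> A \<and> card S = m \<and> (\<forall>r \<le> 0. \<forall>X \<in> [S]\<^bsup>r\<^esup>. f X = (q r :: 'c))"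
    if "m \<le> card A" for A :: "nat set" and f
  proof -
    obtain S where "S \<subseteq> A" "card S = m"
      using obtain_subset_with_card_n[OF \<open>m \<le> card A\<close>] by metis
    then show ?thesis
      by (intro exI[of _ S] exI[of _ "\<lambda>r. f {}"]) simp
  qed
  then show ?case by blast
next
  case (Suc L)
  then obtain N where N: "\<forall>(A :: nat set) f. finite A \<and> N \<le> card A \<and> (\<forall>X. f X \<in> Q) \<longrightarrow>
    (\<exists>S q. S \<subseteq> A \<and> card S = m \<and> (\<forall>r \<le> L. \<forall>X \<in> [S]\<^bsup>r\<^esup>. f X = (q r :: 'c)))"
    by (rule exE)
  obtain M where M: "\<forall>(A :: nat set) f. finite A \<and> M \<le> card A \<and> (\<forall>X. f X \<in> Q) \<longrightarrow>
    (\<exists>S q. S \<subseteq> A \<and> card S = N \<and> (\<forall>X \<in> [S]\<^bsup>Suc L\<^esup>. f X = (q :: 'c)))"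
    using ramsey_finite_colours[OF assms, of N "Suc L"] by (rule exE)
  have "\<exists>S q. S \<subseteq> A \<and> card S = m \<and> (\<forall>r \<le> Suc L. \<forall>X \<in> [S]\<^bsup>r\<^esup>. f X = (q r :: 'c))"
    if A: "finite A" "M \<le> card A" and f: "\<forall>X. f X \<in> Q" for A :: "nat set" and f
  proof -
    obtain B q where B: "B \<subseteq> A" "card B = N" "\<forall>X \<in> [B]\<^bsup>Suc L\<^esup>. f X = q"
      using M[rule_format, of A f] A f by auto
    have "finite B" using B A finite_subset by blast
    then obtain S q' where S: "S \<subseteq> B" "card S = m" "\<forall>r \<le> L. \<forall>X \<in> [S]\<^bsup>r\<^esup>. f X = q' r"
      using N[rule_format, of B f] B(2) f by auto
    have "f X = (q'(Suc L := q)) r" if "r \<le> Suc L" "X \<in> [S]\<^bsup>r\<^esup>" for r X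
    proof (cases "r = Suc L")
      case True
      then show ?thesis
        using that B(3) nsets_mono[OF S(1)] by auto
    next
      case False
      then show ?thesis using that S(3) by simp
    qed
    then show ?thesis
      using S B by (intro exI[of _ S] exI[of _ "q'(Suc L := q)"]) auto
  qed
  then show ?case by blast
qed

text \<open>With the homogeneous set enumerated increasingly by \<open>s\<close>, the later
  constructions choose indices below \<open>m\<close> and apply \<open>s\<close> only at the
  end.\<close>

lemma ramsey_strict_mono:
  fixes m L :: nat
  assumes "finite (Q :: 'c set)"
  shows "\<exists>N. \<forall>f. (\<forall>X. f X \<in> Q) \<longrightarrow>
    (\<exists>s q. strict_mono_on {..<m} s \<and> s ` {..<m} \<subseteq> {..<N :: nat} \<and>
      (\<forall>X. X \<subseteq> {..<m} \<longrightarrow> card X \<le> L \<longrightarrow> f (s ` X) = (q (card X) :: 'c)))"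
proof -
  obtain N where N: "\<forall>(A :: nat set) f. finite A \<and> N \<le> card A \<and> (\<forall>X. f X \<in> Q) \<longrightarrow>
    (\<exists>S q. S \<subseteq> A \<and> card S = m \<and> (\<forall>r \<le> L. \<forall>X \<in> [S]\<^bsup>r\<^esup>. f X = (q r :: 'c)))"
    using ramsey_all_sizes[OF assms, of m L] by (rule exE)
  have "\<exists>s q. strict_mono_on {..<m} s \<and> s ` {..<m} \<subseteq> {..<N} \<and>
      (\<forall>X. X \<subseteq> {..<m} \<longrightarrow> card X \<le> L \<longrightarrow> f (s ` X) = q (card X))"
    if f: "\<forall>X. f X \<in> Q" for f
  proof -
    obtain S q where S: "S \<subseteq> {..<N}" "card S = m" "\<forall>r \<le> L. \<forall>X \<in> [S]\<^bsup>r\<^esup>. f X = q r"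
      using N[rule_format, of "{..<N}" f] f by auto
    have fin: "finite S" using S(1) finite_subset by blast
    define s where "s i = sorted_list_of_set S ! i" for i
    have s: "strict_mono_on {..<m} s"
      using S(2) fin by (auto simp: strict_mono_on_def s_def intro!: sorted_wrt_nth_less[where P = "(<)"])
    have sS: "s ` {..<m} \<subseteq> S"
      using S(2) fin nth_mem[of _ "sorted_list_of_set S"] by (auto simp: s_def)
    have "f (s ` X) = q (card X)" if X: "X \<subseteq> {..<m}" "card X \<le> L" for X
    proof -
      have "card (s ` X) = card X"
        using strict_mono_on_imp_inj_on[OF s] X(1) by (meson card_image inj_on_subset)
      then have "s ` X \<in> [S]\<^bsup>card X\<^esup>"
        using sS X(1) finite_subset[OF X(1)] by (auto simp: nsets_def)
      then show ?thesis using S(3) X(2) by blast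
    qed
    then show ?thesis
      using s sS S(1) by (intro exI[of _ s] exI[of _ q]) blast
  qed
  then show ?thesis by (intro exI[of _ N] allI impI)
qed

section \<open>Towers of sets\<close>

text \<open>The flag selects one of two mirror images, so that the argument for towers is given only
  once; with \<open>True\<close>, children lie to the right of their parents.\<close>

definition beyond :: "bool \<Rightarrow> 'a::linorder \<Rightarrow> 'a \<Rightarrow> bool" where
  "beyond b x w \<longleftrightarrow> (if b then x < w else w < x)"

text \<open>The element inserted last; removing it gives the parent.\<close>

definition tower_pos :: "bool \<times> nat set \<Rightarrow> nat" where
  "tower_pos v = (if fst v then Max (snd v) else Min (snd v))"

definition tower_verts :: "nat \<Rightarrow> (bool \<times> nat set) set" where
  "tower_verts N = {(b, X) | b X. X \<noteq> {} \<and> X \<subseteq> {..<N}}"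

definition tower_edges :: "nat \<Rightarrow> (bool \<times> nat set) set set" where
  "tower_edges N = {{(b, X), (b, insert w X)} | b X w.
     X \<noteq> {} \<and> X \<subseteq> {..<N} \<and> w < N \<and> (\<forall>x \<in> X. beyond b x w)}"

lemma tower_pos_insert:
  assumes "finite X" "\<forall>x \<in> X. beyond b x w"
  shows "tower_pos (b, insert w X) = w" "w \<notin> X"
  using assms by (auto simp: tower_pos_def beyond_def less_imp_le intro!: Max_eqI Min_eqI split: if_splits)

lemma tower_edges_rooted:
  assumes "e \<in> tower_edges N"
  shows "\<exists>v. e = {v, (fst v, snd v - {tower_pos v})} \<and> card (snd v - {tower_pos v}) < card (snd v)"
proof -
  obtain b X w where e: "e = {(b, X), (b, insert w X)}" "X \<subseteq> {..<N}" "\<forall>x \<in> X. beyond b x w"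
    using assms by (auto simp: tower_edges_def)
  have "finite X" using e(2) finite_subset by blast
  then show ?thesis
    using e tower_pos_insert[of X b w] by (intro exI[of _ "(b, insert w X)"]) auto
qed

lemma tower_placed:
  "finite (tower_verts N)" "tower_edges N \<subseteq> [tower_verts N]\<^bsup>2\<^esup>"
proof -
  have "tower_verts N \<subseteq> UNIV \<times> Pow {..<N}"
    by (auto simp: tower_verts_def)
  then show "finite (tower_verts N)"
    by (rule finite_subset) simp
  show "tower_edges N \<subseteq> [tower_verts N]\<^bsup>2\<^esup>"
  proof
    fix e assume "e \<in> tower_edges N"
    then obtain b X w where e: "e = {(b, X), (b, insert w X)}" "X \<noteq> {}" "X \<subseteq> {..<N}" "w < N"
      "\<forall>x \<in> X. beyond b x w"
      by (auto simp: tower_edges_def)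
    have "w \<notin> X" using e by (auto simp: beyond_def split: if_splits)
    then show "e \<in> [tower_verts N]\<^bsup>2\<^esup>"
      using e by (auto simp: tower_verts_def)
  qed
qed

lemma beyond_image:
  assumes "strict_mono_on {..<m} s" "x < m" "w < m" "beyond b x w"
  shows "beyond b (s x) (s w)"
  using assms by (auto simp: beyond_def strict_mono_on_def split: if_splits)

text \<open>\<open>q b l\<close> tells whether the edges of tower \<open>b\<close> with a lower set
  of size \<open>l\<close> are red. The colour of an edge becomes a colour of its larger set, to
  which Ramsey's theorem applies.\<close>

lemma tower_homogeneous:
  fixes m L :: nat
  shows "\<exists>N. \<forall>c. \<exists>s q. strict_mono_on {..<m} s \<and> s ` {..<m} \<subseteq> {..<N :: nat} \<and>
    (\<forall>b X w. X \<noteq> {} \<longrightarrow> X \<subseteq> {..<m} \<longrightarrow> w < m \<longrightarrow> (\<forall>x \<in> X. beyond b x w) \<longrightarrow> card X < L \<longrightarrow>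
      (c {(b, s ` X), (b, s ` insert w X)} = Red \<longleftrightarrow> q b (card X)))"
proof -
  obtain N where N: "\<forall>f. (\<forall>X. f X \<in> (UNIV :: bool set set)) \<longrightarrow>
    (\<exists>s q. strict_mono_on {..<m} s \<and> s ` {..<m} \<subseteq> {..<N :: nat} \<and>
      (\<forall>X. X \<subseteq> {..<m} \<longrightarrow> card X \<le> L \<longrightarrow> f (s ` X) = q (card X)))"
    using ramsey_strict_mono[of "UNIV :: bool set set" m L] by auto
  have "\<exists>s q. strict_mono_on {..<m} s \<and> s ` {..<m} \<subseteq> {..<N} \<and>
    (\<forall>b X w. X \<noteq> {} \<longrightarrow> X \<subseteq> {..<m} \<longrightarrow> w < m \<longrightarrow> (\<forall>x \<in> X. beyond b x w) \<longrightarrow> card X < L \<longrightarrow>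
      (c {(b, s ` X), (b, s ` insert w X)} = Red \<longleftrightarrow> q b (card X)))" for c
  proof -
    \<comment> \<open>The value is the set of flags with a red parent edge at \<open>Y\<close>, so
      one application of Ramsey's theorem handles both towers.\<close>
    define f where "f Y = {b. c {(b, Y - {tower_pos (b, Y)}), (b, Y)} = Red}" for Y
    obtain s q where s: "strict_mono_on {..<m} s" "s ` {..<m} \<subseteq> {..<N}"
      and q: "\<And>X. X \<subseteq> {..<m} \<Longrightarrow> card X \<le> L \<Longrightarrow> f (s ` X) = q (card X)"
      using N[rule_format, of f] by auto
    have "c {(b, s ` X), (b, s ` insert w X)} = Red \<longleftrightarrow> b \<in> q (Suc (card X))"
      if X: "X \<noteq> {}" "X \<subseteq> {..<m}" "w < m" "\<forall>x \<in> X. beyond b x w" "card X < L" for b X w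
    proof -
      have fin: "finite X" using X(2) finite_subset by blast
      have "w \<notin> X" using tower_pos_insert[OF fin X(4)] by simp
      then have "f (s ` insert w X) = q (Suc (card X))"
        using q[of "insert w X"] X fin by auto
      moreover have "\<forall>y \<in> s ` X. beyond b y (s w)"
        using X beyond_image[OF s(1)] by blast
      then have "tower_pos (b, s ` insert w X) = s w" "s w \<notin> s ` X"
        using tower_pos_insert[of "s ` X" b "s w"] fin by auto
      then have eq: "s ` insert w X - {tower_pos (b, s ` insert w X)} = s ` X"
        by auto
      have "b \<in> f (s ` insert w X) \<longleftrightarrow> c {(b, s ` X), (b, s ` insert w X)} = Red"
        unfolding f_def mem_Collect_eq eq ..
      ultimately show ?thesis
        by simp
    qed
    then show ?thesis
      \<comment> \<open>The shift by one turns the size of the larger set of an edge, to which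
        homogeneity refers, into the size of the smaller one.\<close>
      using s by (intro exI[of _ s] exI[of _ "\<lambda>b l. b \<in> q (Suc l)"]) blast
  qed
  then show ?thesis by (intro exI[of _ N] allI)
qed

section \<open>Embedding ordered graphs into towers\<close>

definition up_rel :: "'a::linorder ograph \<Rightarrow> ('a \<Rightarrow> bool) \<Rightarrow> ('a \<times> 'a) set" where
  "up_rel H T = {(u, v). {u, v} \<in> edges H \<and> beyond (T v) u v}"

text \<open>\<open>T\<close> assigns each vertex to a tower. The ancestors of \<open>v\<close>, with
  \<open>v\<close> itself among them, supply the elements of the set that represents
  \<open>v\<close>.\<close>

definition ancestors :: "'a::linorder ograph \<Rightarrow> ('a \<Rightarrow> bool) \<Rightarrow> 'a \<Rightarrow> 'a set" where
  "ancestors H T v = {u. (u, v) \<in> (up_rel H T)\<^sup>*}"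

lemma ancestors_subset:
  assumes "ordered_graph H" "v \<in> verts H"
  shows "ancestors H T v \<subseteq> verts H"
proof
  fix u assume "u \<in> ancestors H T v"
  then have "(u, v) \<in> (up_rel H T)\<^sup>*" by (simp add: ancestors_def)
  then show "u \<in> verts H"
    by (induction rule: converse_rtrancl_induct)
      (use assms ordered_graph_edgeD in \<open>auto simp: up_rel_def\<close>)
qed

lemma self_ancestor: "v \<in> ancestors H T v"
  by (simp add: ancestors_def)

lemma ancestors_beyond:
  assumes T: "\<And>u v. {u, v} \<in> edges H \<Longrightarrow> T u = T v" and "u \<in> ancestors H T v"
  shows "u = v \<or> beyond (T v) u v"
proof -
  have "(u, v) \<in> (up_rel H T)\<^sup>*" using assms(2) by (simp add: ancestors_def)
  then have "T u = T v \<and> (u = v \<or> beyond (T v) u v)"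
  proof induction
    case (step v w)
    then have "T v = T w" using T by (auto simp: up_rel_def)
    then show ?case
      using step by (auto simp: up_rel_def beyond_def split: if_splits)
  qed simp
  then show ?thesis by blast
qed

lemma ancestors_step:
  assumes uniq: "\<And>u v w. {u, v} \<in> edges H \<Longrightarrow> {w, v} \<in> edges H \<Longrightarrow>
      beyond (T v) u v \<Longrightarrow> beyond (T v) w v \<Longrightarrow> u = w"
    and uv: "(u, v) \<in> up_rel H T"
  shows "ancestors H T v = insert v (ancestors H T u)"
proof
  show "ancestors H T v \<subseteq> insert v (ancestors H T u)"
  proof
    fix x assume "x \<in> ancestors H T v"
    then have "(x, v) \<in> (up_rel H T)\<^sup>*" by (simp add: ancestors_def)
    then show "x \<in> insert v (ancestors H T u)"
    proof (cases rule: rtranclE)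
      case (step y)
      then have "y = u" using uniq uv by (auto simp: up_rel_def)
      then show ?thesis using step by (simp add: ancestors_def)
    qed simp
  qed
  show "insert v (ancestors H T u) \<subseteq> ancestors H T v"
    using uv by (auto simp: ancestors_def)
qed

text \<open>A vertex \<open>v\<close> is represented by its ancestors, each encoded as an index,
  together with \<open>z (T v)\<close> filler indices. Ancestors precede \<open>v\<close> in the
  direction of growth, so the set sits at the index of \<open>v\<close>; unique parents make an edge
  of \<open>H\<close> add exactly one index. The fillers lift a whole component to a prescribed
  level without affecting positions.\<close>

lemma tower_copy:
  fixes H :: "'a::linorder ograph"
  assumes H: "ordered_graph H" and K: "card (verts H) \<le> K"
    and T: "\<And>u v. {u, v} \<in> edges H \<Longrightarrow> T u = T v"
    and uniq: "\<And>u v w. {u, v} \<in> edges H \<Longrightarrow> {w, v} \<in> edges H \<Longrightarrow>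
      beyond (T v) u v \<Longrightarrow> beyond (T v) w v \<Longrightarrow> u = w"
    and s: "strict_mono_on {..<3 * K} s" "s ` {..<3 * K} \<subseteq> {..<N}"
    and z: "\<And>b. z b \<le> K"
    and col: "\<And>u v X w. (u, v) \<in> up_rel H T \<Longrightarrow> X \<noteq> {} \<Longrightarrow> X \<subseteq> {..<3 * K} \<Longrightarrow> w < 3 * K \<Longrightarrow>
      \<forall>x \<in> X. beyond (T v) x w \<Longrightarrow> card X = z (T v) + card (ancestors H T u) \<Longrightarrow>
      c {(T v, s ` X), (T v, s ` insert w X)} = col"
  shows "\<exists>\<phi>. placed_copy tower_pos (tower_verts N) (tower_edges N) c col H \<phi>"
proof -
  define idx where "idx v = card {u \<in> verts H. u < v}" for v
  \<comment> \<open>The \<open>3 * K\<close> indices form three blocks. Vertices occupy the middle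
    one; the outer two hold the fillers of the rightward tower (low) and of the leftward tower
    (high), so that fillers always precede vertices in the direction of growth.\<close>
  define y where "y v = K + idx v" for v
  define Z where "Z b = (if b then {..<z b} else {3 * K - z b..<3 * K})" for b
  define A where "A v = Z (T v) \<union> y ` ancestors H T v" for v
  define \<phi> where "\<phi> v = (T v, s ` A v)" for v
  have finH: "finite (verts H)" using H by (simp add: ordered_graph_def)
  have idx_mono: "idx u < idx v" if "u \<in> verts H" "u < v" for u v
    unfolding idx_def using finH that by (intro psubset_card_mono) auto
  have idx_less: "idx v < K" if "v \<in> verts H" for v
  proof -
    have "idx v < card (verts H)"
      unfolding idx_def using finH that by (intro psubset_card_mono) auto
    then show ?thesis using K by simp
  qed
  have y_less: "y v < 2 * K" "K \<le> y v" if "v \<in> verts H" for v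
    using idx_less[OF that] by (auto simp: y_def)
  have y_beyond: "beyond b (y u) (y v)" if "u \<in> verts H" "v \<in> verts H" "beyond b u v" for b u v
    using that idx_mono by (auto simp: beyond_def y_def split: if_splits)
  have Z: "Z b \<subseteq> {..<3 * K}" "card (Z b) = z b" "finite (Z b)" for b
    using z[of b] by (auto simp: Z_def)
  have Z_beyond: "beyond b x (y v)" if "v \<in> verts H" "x \<in> Z b" for b x v
    using y_less[OF that(1)] that(2) z[of b] by (auto simp: Z_def beyond_def split: if_splits)
  have y_range: "y ` ancestors H T v \<subseteq> {..<3 * K}" if v: "v \<in> verts H" for v
    using y_less ancestors_subset[OF H v, of T] by fastforce
  have A: "A v \<subseteq> {..<3 * K}" "A v \<noteq> {}" if "v \<in> verts H" for v
    using Z(1) y_range[OF that] self_ancestor[of v H T] by (auto simp: A_def)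
  have below: "x = y v \<or> beyond (T v) x (y v)" if v: "v \<in> verts H" and x: "x \<in> A v" for v x
    using x unfolding A_def
  proof
    assume "x \<in> y ` ancestors H T v"
    then obtain u where u: "u \<in> ancestors H T v" "x = y u" by blast
    then show ?thesis
      using ancestors_beyond[OF T u(1)] y_beyond ancestors_subset[OF H v, of T] v by blast
  qed (use Z_beyond[OF v] in blast)
  have pos: "tower_pos (\<phi> v) = s (y v)" if v: "v \<in> verts H" for v
  proof -
    have "y v \<in> A v" using self_ancestor[of v H T] by (simp add: A_def)
    then have "A v = insert (y v) (A v - {y v})" by blast
    then have "\<phi> v = (T v, insert (s (y v)) (s ` (A v - {y v})))"
      unfolding \<phi>_def by (metis image_insert)
    moreover have "\<forall>x \<in> s ` (A v - {y v}). beyond (T v) x (s (y v))"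
      using below[OF v] A(1)[OF v] \<open>y v \<in> A v\<close> by (auto intro!: beyond_image[OF s(1)])
    moreover have "finite (A v)"
      using A(1)[OF v] finite_subset by blast
    ultimately show ?thesis
      using tower_pos_insert(1)[of "s ` (A v - {y v})" "T v" "s (y v)"] by simp
  qed
  have up: "{\<phi> u, \<phi> v} \<in> tower_edges N \<and> c {\<phi> u, \<phi> v} = col" if uv: "(u, v) \<in> up_rel H T" for u v
  proof -
    have e: "{u, v} \<in> edges H" "beyond (T v) u v" and Tuv: "T u = T v"
      using uv T by (auto simp: up_rel_def)
    have u: "u \<in> verts H" and v: "v \<in> verts H"
      using ordered_graph_edgeD[OF H e(1)] by auto
    have Av: "A v = insert (y v) (A u)"
      using ancestors_step[of H T u v, OF uniq uv] Tuv by (auto simp: A_def)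
    have bey: "\<forall>x \<in> A u. beyond (T v) x (y v)"
    proof
      fix x assume "x \<in> A u"
      then have "x = y u \<or> beyond (T v) x (y u)" using below[OF u] Tuv by simp
      then show "beyond (T v) x (y v)"
        using y_beyond[OF u v e(2)] by (auto simp: beyond_def split: if_splits)
    qed
    have inj: "inj_on y (ancestors H T u)"
    proof (rule inj_onI)
      fix a b assume ab: "a \<in> ancestors H T u" "b \<in> ancestors H T u" "y a = y b"
      then show "a = b"
        using ancestors_subset[OF H u, of T] idx_mono[of a b] idx_mono[of b a]
        by (cases a b rule: linorder_cases) (auto simp: y_def)
    qed
    have "Z (T u) \<inter> y ` ancestors H T u = {}"
    proof (rule ccontr)
      assume "Z (T u) \<inter> y ` ancestors H T u \<noteq> {}"
      then obtain a where "a \<in> ancestors H T u" "y a \<in> Z (T u)" by blast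
      then show False
        using Z_beyond[of a "y a" "T u"] ancestors_subset[OF H u, of T] by (auto simp: beyond_def split: if_splits)
    qed
    \<comment> \<open>This is the level of the edge, on which the assumption about its colour
      depends; fillers and ancestor indices come from disjoint blocks.\<close>
    then have "card (A u) = z (T v) + card (ancestors H T u)"
      using Z card_image[OF inj] finite_subset[OF ancestors_subset[OF H u] finH] Tuv
      unfolding A_def by (subst card_Un_disjoint) auto
    then have "c {(T v, s ` A u), (T v, s ` insert (y v) (A u))} = col"
      using col[OF uv A(2)[OF u] A(1)[OF u] _ bey] y_less[OF v] by simp
    moreover have "{(T v, s ` A u), (T v, insert (s (y v)) (s ` A u))} \<in> tower_edges N"
      unfolding tower_edges_def
    proof (intro CollectI exI conjI)
      show "\<forall>x \<in> s ` A u. beyond (T v) x (s (y v))"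
        using bey A(1)[OF u] y_less[OF v] by (auto intro!: beyond_image[OF s(1)])
      show "s (y v) < N"
        using subsetD[OF s(2), of "s (y v)"] y_less[OF v] by auto
      show "s ` A u \<subseteq> {..<N}"
        using s(2) A(1)[OF u] by blast
    qed (use A(2)[OF u] in auto)
    ultimately show ?thesis
      unfolding \<phi>_def Av Tuv by simp
  qed
  have "\<phi> ` verts H \<subseteq> tower_verts N"
  proof (rule image_subsetI)
    fix v assume v: "v \<in> verts H"
    have "s ` A v \<subseteq> {..<N}" using s(2) A(1)[OF v] by blast
    then show "\<phi> v \<in> tower_verts N"
      using A(2)[OF v] by (simp add: tower_verts_def \<phi>_def)
  qed
  moreover have "strict_mono_on (verts H) (tower_pos \<circ> \<phi>)"
  proof (rule strict_mono_onI)
    fix u v assume uv: "u \<in> verts H" "v \<in> verts H" "u < v"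
    have "y u < y v" using idx_mono uv by (simp add: y_def)
    then have "s (y u) < s (y v)"
      using s(1) y_less[OF uv(1)] y_less[OF uv(2)] by (intro strict_mono_onD[OF s(1)]) auto
    then show "(tower_pos \<circ> \<phi>) u < (tower_pos \<circ> \<phi>) v"
      using pos uv by simp
  qed
  moreover have "{\<phi> u, \<phi> v} \<in> tower_edges N \<and> c {\<phi> u, \<phi> v} = col"
    if uv: "{u, v} \<in> edges H" "u < v" for u v
  proof (cases "T v")
    case True
    then show ?thesis using up[of u v] uv by (simp add: up_rel_def beyond_def)
  next
    case False
    then have "(v, u) \<in> up_rel H T"
      using uv T[OF uv(1)] edge_sym[OF uv(1)] by (simp add: up_rel_def beyond_def)
    then show ?thesis using up[of v u] by (simp add: insert_commute)
  qed
  ultimately show ?thesis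
    unfolding placed_copy_def by blast
qed

text \<open>If every tower used by \<open>H\<close> has a red level among the first
  \<open>card (verts H')\<close>, that level suffices for \<open>H\<close>: without through vertices
  the parent of any vertex is itself a root. Otherwise some tower used by \<open>H\<close> is blue
  on all these levels, and \<open>H'\<close> embeds there, since chains of ancestors in
  \<open>H'\<close> have at most \<open>card (verts H')\<close> members.\<close>

lemma tower_ramsey:
  fixes H :: "'a::linorder ograph" and H' :: "'b::linorder ograph"
  assumes H: "ordered_graph H" and H': "ordered_graph H'" and nt: "no_through_vertex H"
    and T: "\<And>u v. {u, v} \<in> edges H \<Longrightarrow> T u = T v"
    and uniq: "\<And>u v w. {u, v} \<in> edges H \<Longrightarrow> {w, v} \<in> edges H \<Longrightarrow>
      beyond (T v) u v \<Longrightarrow> beyond (T v) w v \<Longrightarrow> u = w"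
    and left: "\<And>v. v \<in> verts H \<Longrightarrow> T v \<Longrightarrow> left_unique H'"
    and right: "\<And>v. v \<in> verts H \<Longrightarrow> \<not> T v \<Longrightarrow> right_unique H'"
  shows "\<exists>F \<in> ordered_ramsey H H'. forest F"
proof -
  define K where "K = Suc (card (verts H) + card (verts H'))"
  obtain N where N: "\<forall>c. \<exists>s q. strict_mono_on {..<3 * K} s \<and> s ` {..<3 * K} \<subseteq> {..<N :: nat} \<and>
    (\<forall>b X w. X \<noteq> {} \<longrightarrow> X \<subseteq> {..<3 * K} \<longrightarrow> w < 3 * K \<longrightarrow> (\<forall>x \<in> X. beyond b x w) \<longrightarrow>
      card X < 2 * K \<longrightarrow> (c {(b, s ` X), (b, s ` insert w X)} = Red \<longleftrightarrow> q b (card X)))"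
    using tower_homogeneous[of "3 * K" "2 * K"] by (rule exE)
  have "(\<exists>\<phi>. placed_copy tower_pos (tower_verts N) (tower_edges N) c Red H \<phi>) \<or>
      (\<exists>\<phi>. placed_copy tower_pos (tower_verts N) (tower_edges N) c Blue H' \<phi>)" for c
  proof -
    obtain s q where s: "strict_mono_on {..<3 * K} s" "s ` {..<3 * K} \<subseteq> {..<N}"
      and q: "\<And>b X w. X \<noteq> {} \<Longrightarrow> X \<subseteq> {..<3 * K} \<Longrightarrow> w < 3 * K \<Longrightarrow> \<forall>x \<in> X. beyond b x w \<Longrightarrow>
        card X < 2 * K \<Longrightarrow> c {(b, s ` X), (b, s ` insert w X)} = Red \<longleftrightarrow> q b (card X)"
      using N[rule_format, of c] by blast
    show ?thesis
    proof (cases "\<forall>b \<in> T ` verts H. \<exists>l. 1 \<le> l \<and> l \<le> card (verts H') \<and> q b l")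
      case True
      \<comment> \<open>One filler fewer than the red level, because the parent contributes one
        element itself; towers in which \<open>H\<close> has no vertices get the value 0.\<close>
      define z where "z b = (if b \<in> T ` verts H
        then (SOME l. 1 \<le> l \<and> l \<le> card (verts H') \<and> q b l) - 1 else 0)" for b
      have z: "z b < K \<and> q b (Suc (z b))" if "b \<in> T ` verts H" for b
        using someI_ex[OF True[rule_format, OF that]] that by (auto simp: z_def K_def)
      have zK: "z b \<le> K" for b
        using z[of b] by (cases "b \<in> T ` verts H") (auto simp: z_def)
      have "\<exists>\<phi>. placed_copy tower_pos (tower_verts N) (tower_edges N) c Red H \<phi>"
        using H _ T uniq s zK
      proof (rule tower_copy)
        show "card (verts H) \<le> K" by (simp add: K_def)
        fix u v X w
        assume uv: "(u, v) \<in> up_rel H T" and X: "X \<noteq> {}" "X \<subseteq> {..<3 * K}" "w < 3 * K"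
          "\<forall>x \<in> X. beyond (T v) x w" and cX: "card X = z (T v) + card (ancestors H T u)"
        have e: "{u, v} \<in> edges H" "beyond (T v) u v" "T u = T v"
          using uv T by (auto simp: up_rel_def)
        \<comment> \<open>A parent of \<open>u\<close> would lie on the other side of
          \<open>u\<close> from \<open>v\<close> and make \<open>u\<close> a through vertex.\<close>
        have "(x, u) \<notin> up_rel H T" for x
        proof
          assume "(x, u) \<in> up_rel H T"
          then have "{x, u} \<in> edges H" "beyond (T u) x u" by (auto simp: up_rel_def)
          then show False
            using no_through_vertexD[OF nt, of x u v] no_through_vertexD[OF nt, of v u x]
              e edge_sym[of x u] edge_sym[of u v]
            by (auto simp: beyond_def split: if_splits)
        qed
        then have "ancestors H T u = {u}"
          by (auto simp: ancestors_def elim: rtranclE)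
        then have "card X = Suc (z (T v))" using cX by simp
        moreover have "z (T v) < K \<and> q (T v) (Suc (z (T v)))"
          using z ordered_graph_edgeD(2)[OF H e(1)] by blast
        ultimately show "c {(T v, s ` X), (T v, s ` insert w X)} = Red"
          using q[OF X] by simp
      qed
      then show ?thesis ..
    next
      case False
      then obtain v0 where v0: "v0 \<in> verts H"
        and blue: "\<And>l. 1 \<le> l \<Longrightarrow> l \<le> card (verts H') \<Longrightarrow> \<not> q (T v0) l"
        by blast
      \<comment> \<open>All of \<open>H'\<close> goes into the single blue tower and starts at the
        lowest level, hence no fillers.\<close>
      have "\<exists>\<phi>. placed_copy tower_pos (tower_verts N) (tower_edges N) c Blue H' \<phi>"
      proof (rule tower_copy[OF H' _ _ _ s, where T = "\<lambda>_. T v0" and z = "\<lambda>_. 0"])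
        show "card (verts H') \<le> K" by (simp add: K_def)
        show "u = w" if "{u, v} \<in> edges H'" "{w, v} \<in> edges H'" "beyond (T v0) u v" "beyond (T v0) w v"
          for u v w
          using left[OF v0] right[OF v0] left_uniqueD[of H' u v w] right_uniqueD[of H' u v w] that
          by (auto simp: beyond_def split: if_splits)
        fix u v X w
        assume uv: "(u, v) \<in> up_rel H' (\<lambda>_. T v0)" and X: "X \<noteq> {}" "X \<subseteq> {..<3 * K}" "w < 3 * K"
          "\<forall>x \<in> X. beyond (T v0) x w" and cX: "card X = 0 + card (ancestors H' (\<lambda>_. T v0) u)"
        have "u \<in> verts H'"
          using uv ordered_graph_edgeD[OF H'] by (auto simp: up_rel_def)
        then have "card X \<le> card (verts H')"
          using cX ancestors_subset[OF H'] H' by (auto simp: ordered_graph_def intro: card_mono)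
        moreover have "1 \<le> card X"
          using X(1,2) by (metis One_nat_def Suc_leI card_gt_0_iff finite_lessThan finite_subset)
        ultimately have "c {(T v0, s ` X), (T v0, s ` insert w X)} \<noteq> Red"
          using q[OF X] blue by (simp add: K_def)
        then show "c {(T v0, s ` X), (T v0, s ` insert w X)} = Blue"
          by (cases "c {(T v0, s ` X), (T v0, s ` insert w X)}") auto
      qed auto
      then show ?thesis ..
    qed
  qed
  then have "placed_ramsey tower_pos (tower_verts N) (tower_edges N) H H'"
    using tower_placed by (simp add: placed_ramsey_def)
  then show ?thesis
    using tower_edges_rooted
    by (intro placed_ramsey_imp_forest[OF H H', where p = "\<lambda>v. (fst v, snd v - {tower_pos v})"
          and rk = "\<lambda>v. card (snd v)"]) auto
qed

text \<open>Only the tower growing to the right is used; the next lemma uses its mirror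
  image.\<close>

lemma right_stars_ramsey:
  assumes "ordered_graph H" "ordered_graph H'" "no_through_vertex H" "left_unique H" "left_unique H'"
  shows "\<exists>F \<in> ordered_ramsey H H'. forest F"
  using assms left_uniqueD[of H]
  by (intro tower_ramsey[where T = "\<lambda>_. True"]) (auto simp: beyond_def)

lemma left_stars_ramsey:
  assumes "ordered_graph H" "ordered_graph H'" "no_through_vertex H" "right_unique H" "right_unique H'"
  shows "\<exists>F \<in> ordered_ramsey H H'. forest F"
  using assms right_uniqueD[of H]
  by (intro tower_ramsey[where T = "\<lambda>_. False"]) (auto simp: beyond_def)

text \<open>Left stars with several leaves go into the leftward tower, all other components of
  \<open>H\<close> into the rightward one. Since \<open>H'\<close> has unique neighbours on both
  sides, it fits into whichever tower turns out blue.\<close>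

lemma stars_monotone_paths_ramsey:
  assumes H: "ordered_graph H" and H': "ordered_graph H'"
    and nt: "no_through_vertex H" and nz: "no_zigzag H"
    and lu: "left_unique H'" and ru: "right_unique H'"
  shows "\<exists>F \<in> ordered_ramsey H H'. forest F"
proof -
  define R where "R u v \<longleftrightarrow> {u, v} \<in> edges H \<and> u < v" for u v
  \<comment> \<open>True unless an edge at \<open>x\<close> has a right end with a second left
    neighbour, that is, unless the component is a left star with at least two leaves. Isolated
    vertices and single edges count as right stars.\<close>
  define T where "T x \<longleftrightarrow> (\<forall>u v w. R u v \<longrightarrow> x = u \<or> x = v \<longrightarrow> R w v \<longrightarrow> w = u)" for x
  have through: False if "R u v" "R v w" for u v w
    using that no_through_vertexD[OF nt] by (auto simp: R_def)
  have zigzag: "a = c \<or> b = d" if "R a b" "R c b" "R c d" for a b c d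
    using that no_zigzagD[OF nz] by (auto simp: R_def)
  have TR: "T u = T v" if e: "R u v" for u v
  proof
    assume u: "T u"
    have left: "w = u" if "R w v" for w
      using u e that unfolding T_def by blast
    show "T v"
      unfolding T_def using left through e by blast
  next
    assume v: "T v"
    have left: "w = u" if "R w v" for w
      using v e that unfolding T_def by blast
    show "T u"
      unfolding T_def using left through e zigzag by blast
  qed
  have edge: "R u v \<or> R v u" if "{u, v} \<in> edges H" for u v
    using that edge_sym[OF that] ordered_graph_edgeD(3)[OF H that] by (auto simp: R_def)
  have uniqT: "u = w" if "R u v" "R w v" "T v" for u v w
    using that unfolding T_def by blast
  \<comment> \<open>The witness against \<open>T v\<close> is an edge \<open>R a b\<close> at
    \<open>v\<close> with a second left neighbour \<open>d\<close> of \<open>b\<close>. If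
    \<open>v = b\<close>, a right neighbour of \<open>v\<close> makes it a through vertex. If
    \<open>v = a\<close>, a right neighbour other than \<open>b\<close> completes a zigzag, so
    \<open>u\<close> and \<open>w\<close> both equal \<open>b\<close>.\<close>
  have uniqF: "u = w" if R: "R v u" "R v w" and notT: "\<not> T v" for u v w
  proof -
    obtain a b d where "R a b" "v = a \<or> v = b" "R d b" "d \<noteq> a"
      using notT unfolding T_def by blast
    then show ?thesis
      using through zigzag R by blast
  qed
  show ?thesis
  proof (rule tower_ramsey[OF H H' nt, where T = T])
    show "T u = T v" if "{u, v} \<in> edges H" for u v
      using edge[OF that] TR by blast
    show "u = w" if "{u, v} \<in> edges H" "{w, v} \<in> edges H" "beyond (T v) u v" "beyond (T v) w v" for u v w
      using that uniqT[of u v w] uniqF[of v u w] edge_sym[of u v] edge_sym[of w v]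
      by (auto simp: beyond_def R_def split: if_splits)
  qed (use lu ru in auto)
qed

section \<open>Matchings\<close>

definition rank_in :: "'a::linorder ograph \<Rightarrow> 'a \<Rightarrow> nat" where
  "rank_in H v = card {u \<in> verts H. u < v}"

lemma rank_in_less:
  assumes "ordered_graph H" "u \<in> verts H" "u < v"
  shows "rank_in H u < rank_in H v"
  using assms unfolding rank_in_def ordered_graph_def by (intro psubset_card_mono) auto

lemma rank_in_bound:
  assumes "ordered_graph H" "v \<in> verts H"
  shows "rank_in H v < card (verts H)"
  using assms unfolding rank_in_def ordered_graph_def by (intro psubset_card_mono) auto

text \<open>The copy of \<open>H'\<close> indexed by \<open>X\<close> occupies the positions in
  \<open>X\<close> in order. Copies for different \<open>X\<close> are vertex-disjoint even where
  their positions overlap.\<close>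

definition copies_pos :: "'b::linorder ograph \<Rightarrow> nat set \<times> 'b \<Rightarrow> nat" where
  "copies_pos H x = sorted_list_of_set (fst x) ! rank_in H (snd x)"

definition copies_verts :: "'b::linorder ograph \<Rightarrow> nat \<Rightarrow> (nat set \<times> 'b) set" where
  "copies_verts H N = [{..<N}]\<^bsup>card (verts H)\<^esup> \<times> verts H"

definition copies_edges :: "'b::linorder ograph \<Rightarrow> nat \<Rightarrow> (nat set \<times> 'b) set set" where
  "copies_edges H N = {Pair X ` e | X e. X \<in> [{..<N}]\<^bsup>card (verts H)\<^esup> \<and> e \<in> edges H}"

lemma copies_pos_image:
  assumes H: "ordered_graph H" and v: "v \<in> verts H"
    and g: "strict_mono_on {..<card (verts H)} g"
  shows "copies_pos H (g ` {..<card (verts H)}, v) = g (rank_in H v)"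
proof -
  let ?n = "card (verts H)"
  have "sorted_wrt (<) (map g [0..<?n])"
    using g by (auto simp: sorted_wrt_iff_nth_less strict_mono_on_def)
  then have "sorted_list_of_set (set (map g [0..<?n])) = map g [0..<?n]"
    by (intro sorted_list_of_set.idem_if_sorted_distinct) (auto simp: strict_sorted_iff)
  then have "sorted_list_of_set (g ` {..<?n}) = map g [0..<?n]"
    by (simp add: atLeast0LessThan)
  then show ?thesis
    using rank_in_bound[OF H v] by (simp add: copies_pos_def)
qed

lemma copies_placed:
  assumes H: "ordered_graph H"
  shows "finite (copies_verts H N)" "copies_edges H N \<subseteq> [copies_verts H N]\<^bsup>2\<^esup>"
proof -
  show "finite (copies_verts H N)"
    using H by (simp add: copies_verts_def finite_imp_finite_nsets ordered_graph_def)
  show "copies_edges H N \<subseteq> [copies_verts H N]\<^bsup>2\<^esup>"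
  proof
    fix e' assume "e' \<in> copies_edges H N"
    then obtain X e where e: "e' = Pair X ` e" "X \<in> [{..<N}]\<^bsup>card (verts H)\<^esup>" "e \<in> edges H"
      by (auto simp: copies_edges_def)
    obtain u v where "e = {u, v}" "u < v" "u \<in> verts H" "v \<in> verts H"
      using ordered_graph_edgeE[OF H e(3)] .
    then show "e' \<in> [copies_verts H N]\<^bsup>2\<^esup>"
      using e by (auto simp: copies_verts_def)
  qed
qed

text \<open>If no copy indexed by the homogeneous set has a red edge, any of them is a blue
  \<open>H'\<close>. Otherwise the same edge \<open>ab\<close> of \<open>H'\<close> is chosen red in
  all of them. Each edge of \<open>H\<close> is then realised by \<open>ab\<close> in a copy that
  places \<open>a\<close> and \<open>b\<close> where its two ends belong; since \<open>H\<close> is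
  a matching, no vertex is claimed by two copies.\<close>

lemma copies_ramsey:
  fixes H :: "'a::linorder ograph" and H' :: "'b::linorder ograph"
  assumes H: "ordered_graph H" and H': "ordered_graph H'" and pm: "partial_matching H"
  obtains N where "placed_ramsey (copies_pos H') (copies_verts H' N) (copies_edges H' N) H H'"
proof -
  let ?n = "card (verts H')"
  \<comment> \<open>One block of length \<open>?n\<close> for each vertex of \<open>H\<close> and
    two more: one before the first vertex and one after the last.\<close>
  define m where "m = (card (verts H) + 2) * ?n"
  define Q where "Q = {(a, b). {a, b} \<in> edges H' \<and> a < b}"
  have "finite Q"
  proof (rule finite_subset)
    show "Q \<subseteq> verts H' \<times> verts H'"
      using ordered_graph_edgeD[OF H'] by (auto simp: Q_def)
    show "finite (verts H' \<times> verts H')"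
      using H' by (simp add: ordered_graph_def)
  qed
  then have finQ: "finite (insert None (Some ` Q))" by simp
  obtain N where N: "\<forall>f. (\<forall>X. f X \<in> insert None (Some ` Q)) \<longrightarrow>
    (\<exists>s q. strict_mono_on {..<m} s \<and> s ` {..<m} \<subseteq> {..<N :: nat} \<and>
      (\<forall>X. X \<subseteq> {..<m} \<longrightarrow> card X \<le> ?n \<longrightarrow> f (s ` X) = q (card X)))"
    using ramsey_strict_mono[OF finQ, of m ?n] by (rule exE)
  let ?V = "copies_verts H' N" and ?E = "copies_edges H' N"
  have "(\<exists>\<phi>. placed_copy (copies_pos H') ?V ?E c Red H \<phi>) \<or>
      (\<exists>\<phi>. placed_copy (copies_pos H') ?V ?E c Blue H' \<phi>)" for c
  proof -
    define red where "red X ab \<longleftrightarrow> ab \<in> Q \<and> c {(X, fst ab), (X, snd ab)} = Red" for X ab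
    \<comment> \<open>\<open>None\<close> stands for a copy without red edges. The chosen edge is an
      ordered pair with increasing entries, so it is known which end lies to the left.\<close>
    define f where "f X = (if \<exists>ab. red X ab then Some (SOME ab. red X ab) else None)" for X
    have redQ: "ab \<in> Q" if "red X ab" for X ab
      using that by (simp add: red_def)
    have f_Some: "red X ab" if "f X = Some ab" for X ab
    proof (cases "\<exists>ab. red X ab")
      case True
      then show ?thesis using that someI_ex[OF True] by (simp add: f_def)
    qed (use that in \<open>simp add: f_def\<close>)
    have fQ: "f X \<in> insert None (Some ` Q)" for X
    proof (cases "f X")
      case (Some ab)
      then have "ab \<in> Q" using f_Some redQ by blast
      then show ?thesis using Some by simp
    qed simp
    have "\<forall>X. f X \<in> insert None (Some ` Q)" using fQ by (rule allI)
    with N have "\<exists>s q. strict_mono_on {..<m} s \<and> s ` {..<m} \<subseteq> {..<N} \<and>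
        (\<forall>X. X \<subseteq> {..<m} \<longrightarrow> card X \<le> ?n \<longrightarrow> f (s ` X) = q (card X))"
      by (elim allE[of _ f] mp)
    then obtain s q where s: "strict_mono_on {..<m} s" "s ` {..<m} \<subseteq> {..<N}"
      and q: "\<And>X. X \<subseteq> {..<m} \<Longrightarrow> card X \<le> ?n \<Longrightarrow> f (s ` X) = q (card X)"
      by (elim exE conjE) simp
    have st: "strict_mono_on {..<?n} (s \<circ> t)" "(s \<circ> t) ` {..<?n} \<in> [{..<N}]\<^bsup>?n\<^esup>"
      "f ((s \<circ> t) ` {..<?n}) = q ?n"
      if t: "strict_mono_on {..<?n} t" "t ` {..<?n} \<subseteq> {..<m}" for t
    proof -
      show mono: "strict_mono_on {..<?n} (s \<circ> t)"
      proof (rule strict_mono_onI)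
        fix i j assume ij: "i \<in> {..<?n}" "j \<in> {..<?n}" "i < j"
        have "t i \<in> {..<m}" "t j \<in> {..<m}" using t(2) ij by blast+
        then show "(s \<circ> t) i < (s \<circ> t) j"
          using strict_mono_onD[OF s(1) _ _ strict_mono_onD[OF t(1) ij]] by simp
      qed
      have "(s \<circ> t) ` {..<?n} \<subseteq> {..<N}"
        using s(2) t(2) by (auto simp: image_subset_iff)
      then show "(s \<circ> t) ` {..<?n} \<in> [{..<N}]\<^bsup>?n\<^esup>"
        using card_image[OF strict_mono_on_imp_inj_on[OF mono]] unfolding nsets_def by simp
      show "f ((s \<circ> t) ` {..<?n}) = q ?n"
        using q[OF t(2)] card_image[OF strict_mono_on_imp_inj_on[OF t(1)]]
        by (simp add: image_comp)
    qed
    show ?thesis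
    proof (cases "q ?n")
      case None
      have m: "?n \<le> m" by (simp add: m_def)
      define X where "X = (s \<circ> (\<lambda>i. i)) ` {..<?n}"
      have X: "strict_mono_on {..<?n} s" "X \<in> [{..<N}]\<^bsup>?n\<^esup>" "f X = None"
        using st[of "\<lambda>i. i"] m None by (auto simp: X_def strict_mono_on_def comp_def)
      have pos: "copies_pos H' (X, v) = s (rank_in H' v)" if "v \<in> verts H'" for v
        using copies_pos_image[OF H' that X(1)] by (simp add: X_def)
      have "placed_copy (copies_pos H') ?V ?E c Blue H' (Pair X)"
        unfolding placed_copy_def
      proof (intro conjI allI impI)
        show "Pair X ` verts H' \<subseteq> ?V"
          using X by (auto simp: copies_verts_def)
        show "strict_mono_on (verts H') (copies_pos H' \<circ> Pair X)"
          using pos rank_in_less[OF H'] rank_in_bound[OF H'] X(1)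
          by (auto simp: strict_mono_on_def)
        fix u v assume uv: "{u, v} \<in> edges H'" "u < v"
        have "{(X, u), (X, v)} = Pair X ` {u, v}" by simp
        then show "{(X, u), (X, v)} \<in> ?E"
          unfolding copies_edges_def using X(2) uv(1) by blast
        have "\<not> red X (u, v)"
          using X(3) by (auto simp: f_def split: if_splits)
        then show "c {(X, u), (X, v)} = Blue"
          using uv by (cases "c {(X, u), (X, v)}") (auto simp: red_def Q_def)
      qed
      then show ?thesis by blast
    next
      case (Some ab)
      obtain a b where ab: "ab = (a, b)" by (cases ab)
      have "red ((s \<circ> (\<lambda>i. i)) ` {..<?n}) ab"
        using st(3)[of "\<lambda>i. i"] Some by (intro f_Some) (auto simp: m_def strict_mono_on_def)
      then have e: "{a, b} \<in> edges H'" "a < b"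
        by (auto simp: red_def ab Q_def)
      note abv = ordered_graph_edgeD(1,2)[OF H' e(1)]
      define i0 where "i0 = rank_in H' a"
      define j0 where "j0 = rank_in H' b"
      have ij: "i0 < j0" "j0 < ?n"
        using rank_in_less[OF H' abv(1) e(2)] rank_in_bound[OF H' abv(2)] by (auto simp: i0_def j0_def)
      \<comment> \<open>An increasing choice of \<open>?n\<close> indices with prescribed values
        \<open>x\<close> at the rank of \<open>a\<close> and \<open>y\<close> at the rank of
        \<open>b\<close>: ranks below \<open>j0\<close> run consecutively through \<open>x\<close>,
        the others start at \<open>y\<close>.\<close>
      define t where "t x y i = (if i < j0 then x + i - i0 else y + i - j0)" for x y i
      define P where "P x y = (s \<circ> t x y) ` {..<?n}" for x y
      \<comment> \<open>Room for the other vertices: \<open>?n \<le> x\<close> keeps the truncated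
        subtraction in \<open>t\<close> exact, and the gap of \<open>?n\<close> separates the two
        runs.\<close>
      define ok where "ok x y \<longleftrightarrow> ?n \<le> x \<and> x + ?n \<le> y \<and> y + ?n \<le> m" for x y
      have t: "strict_mono_on {..<?n} (t x y)" "t x y ` {..<?n} \<subseteq> {..<m}" if "ok x y" for x y
      proof -
        show "strict_mono_on {..<?n} (t x y)"
          by (rule strict_mono_onI) (use ij that in \<open>auto simp: t_def ok_def\<close>)
        show "t x y ` {..<?n} \<subseteq> {..<m}"
          using ij that by (auto simp: t_def ok_def)
      qed
      have P_red: "red (P x y) (a, b)" if "ok x y" for x y
        using st(3)[OF t[OF that]] Some ab by (intro f_Some) (simp add: P_def)
      have P_verts: "P x y \<in> [{..<N}]\<^bsup>?n\<^esup>" "(P x y, a) \<in> ?V" "(P x y, b) \<in> ?V" if "ok x y" for x y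
        using st(2)[OF t[OF that]] abv by (auto simp: P_def copies_verts_def)
      have P_pos: "copies_pos H' (P x y, a) = s x" "copies_pos H' (P x y, b) = s y" if "ok x y" for x y
        using copies_pos_image[OF H' abv(1) st(1)[OF t[OF that]]]
          copies_pos_image[OF H' abv(2) st(1)[OF t[OF that]]] ij
        by (auto simp: P_def t_def i0_def[symmetric] j0_def[symmetric])
      define k where "k v = Suc (rank_in H v) * ?n" for v
      have k_m: "k v + ?n + ?n \<le> m" if "v \<in> verts H" for v
      proof -
        have "k v + ?n + ?n = (rank_in H v + 3) * ?n" by (simp add: k_def algebra_simps)
        also have "\<dots> \<le> m"
          unfolding m_def using rank_in_bound[OF H that] by (intro mult_le_mono1) simp
        finally show ?thesis .
      qed
      have k_less: "k u + ?n \<le> k v" if "u \<in> verts H" "u < v" for u v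
      proof -
        have "k u + ?n = (rank_in H u + 2) * ?n" by (simp add: k_def)
        also have "\<dots> \<le> k v"
          unfolding k_def using rank_in_less[OF H that] by (intro mult_le_mono1) simp
        finally show ?thesis .
      qed
      have ok: "ok (k u) (k v)" if "{u, v} \<in> edges H" "u < v" for u v
        using k_less[of u v] k_m[of v] ordered_graph_edgeD[OF H that(1)] that(2)
        by (auto simp: ok_def k_def)
      \<comment> \<open>An isolated vertex of \<open>H\<close> gets a copy of its own, with
        \<open>b\<close> placed in a spare position one block further on.\<close>
      have ok': "ok (k v) (k v + ?n)" if "v \<in> verts H" for v
        using k_m[OF that] by (auto simp: ok_def k_def)
      have mate: "u = w" if "{u, v} \<in> edges H" "{v, w} \<in> edges H" for u v w
        using that pm unfolding partial_matching_def by blast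
      \<comment> \<open>The left end of an edge becomes \<open>a\<close> and the right end
        \<open>b\<close> of the same copy; an isolated vertex becomes \<open>a\<close>. In every
        case the position is \<open>s (k v)\<close>, so the order of \<open>H\<close> is
        preserved.\<close>
      define \<phi> where "\<phi> v =
        (if \<exists>w. {v, w} \<in> edges H \<and> v < w then (P (k v) (k (THE w. {v, w} \<in> edges H)), a)
         else if \<exists>u. {u, v} \<in> edges H then (P (k (THE u. {u, v} \<in> edges H)) (k v), b)
         else (P (k v) (k v + ?n), a))" for v
      have \<phi>_edge: "\<phi> u = (P (k u) (k v), a) \<and> \<phi> v = (P (k u) (k v), b)"
        if uv: "{u, v} \<in> edges H" "u < v" for u v
      proof -
        have "(THE w. {u, w} \<in> edges H) = v" "(THE w. {w, v} \<in> edges H) = u"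
          using uv(1) mate edge_sym[OF uv(1)] by (auto intro!: the_equality dest: edge_sym)
        moreover have "\<not> (\<exists>w. {v, w} \<in> edges H \<and> v < w)"
          using mate[OF uv(1)] uv(2) by (auto dest: less_asym)
        ultimately show ?thesis
          using uv by (auto simp: \<phi>_def)
      qed
      have \<phi>: "\<phi> v \<in> ?V \<and> copies_pos H' (\<phi> v) = s (k v)" if v: "v \<in> verts H" for v
      proof (cases "\<exists>w. {v, w} \<in> edges H")
        case True
        then obtain w where w: "{v, w} \<in> edges H" by blast
        then have "v < w \<or> {w, v} \<in> edges H \<and> w < v"
          using ordered_graph_edgeD(3)[OF H w] edge_sym[OF w] by auto
        then show ?thesis
          using \<phi>_edge[of v w] \<phi>_edge[of w v] ok[of v w] ok[of w v] P_verts P_pos w by auto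
      next
        case False
        then have "\<phi> v = (P (k v) (k v + ?n), a)"
          using edge_sym[of _ v H] by (auto simp: \<phi>_def)
        then show ?thesis
          using P_verts P_pos ok'[OF v] by simp
      qed
      have "placed_copy (copies_pos H') ?V ?E c Red H \<phi>"
        unfolding placed_copy_def
      proof (intro conjI allI impI)
        show "\<phi> ` verts H \<subseteq> ?V"
          using \<phi> by blast
        show "strict_mono_on (verts H) (copies_pos H' \<circ> \<phi>)"
        proof (rule strict_mono_onI)
          fix u v assume uv: "u \<in> verts H" "v \<in> verts H" "u < v"
          have "k u < k v" "k v < m"
            using k_less[OF uv(1,3)] k_m[OF uv(2)] ij by auto
          then show "(copies_pos H' \<circ> \<phi>) u < (copies_pos H' \<circ> \<phi>) v"
            using \<phi> uv strict_mono_onD[OF s(1)] by simp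
        qed
        fix u v assume uv: "{u, v} \<in> edges H" "u < v"
        have eq: "{\<phi> u, \<phi> v} = Pair (P (k u) (k v)) ` {a, b}"
          using \<phi>_edge[OF uv] by simp
        then show "{\<phi> u, \<phi> v} \<in> ?E"
          unfolding copies_edges_def using P_verts(1)[OF ok[OF uv]] e(1) by blast
        show "c {\<phi> u, \<phi> v} = Red"
          using P_red[OF ok[OF uv]] \<phi>_edge[OF uv] by (simp add: red_def)
      qed
      then show ?thesis by blast
    qed
  qed
  then have "placed_ramsey (copies_pos H') ?V ?E H H'"
    using copies_placed[OF H'] by (simp add: placed_ramsey_def)
  then show thesis by (rule that)
qed

text \<open>The graph of copies is a disjoint union of copies of \<open>H'\<close>, so parents and
  ranks are inherited in each copy. The same disjointness gives the version with matchings
  below.\<close>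

lemma matching_forest_ramsey:
  assumes H: "ordered_graph H" and H': "ordered_graph H'"
    and pm: "partial_matching H" and "forest H'"
  shows "\<exists>F \<in> ordered_ramsey H H'. forest F"
proof -
  obtain N where N: "placed_ramsey (copies_pos H') (copies_verts H' N) (copies_edges H' N) H H'"
    using copies_ramsey[OF H H' pm] .
  obtain p rk where pr: "\<And>e. e \<in> edges H' \<Longrightarrow> \<exists>v. e = {v, p v} \<and> rk (p v) < (rk v :: nat)"
    using forest_imp_rooted[OF H' \<open>forest H'\<close>] by (auto simp: rooted_def)
  have "\<exists>v. e' = {v, (fst v, p (snd v))} \<and> rk (snd (fst v, p (snd v))) < rk (snd v)"
    if e': "e' \<in> copies_edges H' N" for e'
  proof -
    obtain X e where e: "e' = Pair X ` e" "e \<in> edges H'"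
      using e' by (auto simp: copies_edges_def)
    then obtain v where "e = {v, p v}" "rk (p v) < rk v"
      using pr by blast
    then show ?thesis
      using e by (intro exI[of _ "(X, v)"]) auto
  qed
  then show ?thesis
    by (intro placed_ramsey_imp_forest[OF H H' N, where p = "\<lambda>v. (fst v, p (snd v))"
          and rk = "\<lambda>v. rk (snd v)"])
qed

lemma matchings_ramsey:
  assumes H: "ordered_graph H" and H': "ordered_graph H'"
    and pm: "partial_matching H" and pm': "partial_matching H'"
  shows "\<exists>F \<in> ordered_ramsey H H'. partial_matching F"
proof -
  obtain N where N: "placed_ramsey (copies_pos H') (copies_verts H' N) (copies_edges H' N) H H'"
    using copies_ramsey[OF H H' pm] .
  have disj: "d = e" if de: "d \<in> edges H'" "e \<in> edges H'" "x \<in> d" "x \<in> e" for d e x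
  proof -
    obtain u v where d: "d = {u, v}"
      using ordered_graph_edgeE[OF H' de(1)] by metis
    obtain y z where e: "e = {y, z}"
      using ordered_graph_edgeE[OF H' de(2)] by metis
    obtain u' where u': "d = {u', x}"
      using d de(3) by (auto simp: insert_commute)
    obtain y' where y': "e = {x, y'}"
      using e de(4) by (auto simp: insert_commute)
    have "u' = y'"
      using pm' de u' y' unfolding partial_matching_def by blast
    then show ?thesis using u' y' by (simp add: insert_commute)
  qed
  show ?thesis
  proof (rule placed_ramsey_imp_partial_matching[OF H H' N])
    fix d' e' assume de': "d' \<in> copies_edges H' N" "e' \<in> copies_edges H' N" "d' \<inter> e' \<noteq> {}"
    obtain X d where d: "d' = Pair X ` d" "d \<in> edges H'"
      using de'(1) by (auto simp: copies_edges_def)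
    obtain Y e where e: "e' = Pair Y ` e" "e \<in> edges H'"
      using de'(2) by (auto simp: copies_edges_def)
    obtain x where "X = Y" "x \<in> d" "x \<in> e"
      using de'(3) d(1) e(1) by auto
    then show "d' = e'"
      using disj[OF d(2) e(2), of x] d(1) e(1) by simp
  qed
qed

section \<open>Characterisation\<close>

lemma ordered_ramsey_commute:
  fixes H :: "'a::linorder ograph" and H' :: "'b::linorder ograph"
  shows "ordered_ramsey H H' = ordered_ramsey H' H"
proof -
  have sub: "ordered_ramsey G G' \<subseteq> ordered_ramsey G' G"
    for G :: "'c::linorder ograph" and G' :: "'d::linorder ograph"
  proof
    fix F assume F: "F \<in> ordered_ramsey G G'"
    have "(\<exists>C. is_copy C G' F \<and> (\<forall>e \<in> edges C. c e = Red)) \<or>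
        (\<exists>C. is_copy C G F \<and> (\<forall>e \<in> edges C. c e = Blue))" for c :: "nat set \<Rightarrow> colour"
    proof -
      define c' where "c' e = (if c e = Red then Blue else Red)" for e
      have c': "c' e = Red \<longleftrightarrow> c e = Blue" "c' e = Blue \<longleftrightarrow> c e = Red" for e
        by (cases "c e"; simp add: c'_def)+
      have "(\<exists>C. is_copy C G F \<and> (\<forall>e \<in> edges C. c' e = Red)) \<or>
          (\<exists>C. is_copy C G' F \<and> (\<forall>e \<in> edges C. c' e = Blue))"
        using F by (simp add: ordered_ramsey_def)
      then show ?thesis unfolding c' by blast
    qed
    then show "F \<in> ordered_ramsey G' G"
      using F by (simp add: ordered_ramsey_def)
  qed
  show ?thesis
    using sub[of H H'] sub[of H' H] by (rule equalityI)
qed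

lemma partial_matching_subgraph_copy:
  assumes "partial_matching F" "is_copy C H F" "ordered_graph H"
  shows "partial_matching H"
proof -
  obtain f where f: "inj_on f (verts H)" "edges C = (\<lambda>e. f ` e) ` edges H"
    using assms(2) by (auto simp: is_copy_def ordered_iso_def bij_betw_def)
  have edge: "{f u, f v} \<in> edges F" if "{u, v} \<in> edges H" for u v
  proof -
    have "{f u, f v} \<in> edges C"
      unfolding f(2) using imageI[OF that, of "\<lambda>e. f ` e"] by simp
    then show ?thesis
      using assms(2) by (auto simp: is_copy_def subgraph_def)
  qed
  show ?thesis
    unfolding partial_matching_def
  proof clarify
    fix u v w assume uvw: "{u, v} \<in> edges H" "{v, w} \<in> edges H" and "u \<noteq> w"
    have "f u = f w"
      using assms(1) edge[OF uvw(1)] edge[OF uvw(2)] unfolding partial_matching_def by blast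
    then have "u = w"
      using f(1) ordered_graph_edgeD[OF assms(3)] uvw by (meson inj_onD)
    then show False using \<open>u \<noteq> w\<close> by simp
  qed
qed

text \<open>Under a constant colouring the other alternative would need an edge of a colour that is
  absent.\<close>

lemma ordered_ramsey_monochromatic:
  assumes F: "F \<in> ordered_ramsey H H'" and ne: "edges H \<noteq> {}" "edges H' \<noteq> {}"
  shows "\<exists>C. is_copy C H F" "\<exists>C. is_copy C H' F"
proof -
  have nonempty: "edges C \<noteq> {}" if "is_copy C K F" "edges K \<noteq> {}" for C and K :: "'c::linorder ograph"
    using that by (auto simp: is_copy_def ordered_iso_def)
  have all: "(\<exists>C. is_copy C H F \<and> (\<forall>e \<in> edges C. c e = Red)) \<or>
      (\<exists>C. is_copy C H' F \<and> (\<forall>e \<in> edges C. c e = Blue))" for c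
    using F by (simp add: ordered_ramsey_def)
  show "\<exists>C. is_copy C H F"
    using all[of "\<lambda>_. Red"] nonempty[OF _ ne(2)] by auto
  show "\<exists>C. is_copy C H' F"
    using all[of "\<lambda>_. Blue"] nonempty[OF _ ne(1)] by auto
qed

text \<open>An infimum is below 1 exactly when some member is. Every member contains an edge, so its
  density is a maximum over a nonempty set.\<close>

lemma ramsey_density_less_1_iff:
  assumes "edges H \<noteq> {}" "edges H' \<noteq> {}"
  shows "ramsey_density H H' < 1 \<longleftrightarrow> (\<exists>F \<in> ordered_ramsey H H'. forest F)"
proof -
  have "graph_density F < 1 \<longleftrightarrow> forest F" if F: "F \<in> ordered_ramsey H H'" for F
  proof (rule density_less_1_iff_forest)
    show G: "ordered_graph F"
      using F by (simp add: ordered_ramsey_def)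
    obtain C where C: "is_copy C H F"
      using ordered_ramsey_monochromatic(1)[OF F assms] by blast
    then have "edges C \<noteq> {}" "edges C \<subseteq> edges F"
      using assms(1) by (auto simp: is_copy_def ordered_iso_def subgraph_def)
    then show "verts F \<noteq> {}"
      using ordered_graph_edgeE[OF G] by blast
  qed
  then show ?thesis
    by (simp add: ramsey_density_def INF_less_iff)
qed

theorem theorem3:
  fixes H :: "'a::linorder ograph" and H' :: "'b::linorder ograph"
  assumes "ordered_graph H" and "ordered_graph H'"
    and "edges H \<noteq> {}" and "edges H' \<noteq> {}"
  shows "(ramsey_density H H' < 1 \<longleftrightarrow>
           forest H \<and> forest H' \<and>
           ((partial_matching H \<or> partial_matching H') \<or>
            (((\<forall>C \<in> components H. right_star C) \<and> (\<forall>v \<in> verts H'. card (left_nbrs H' v) \<le> 1)) \<or>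
             ((\<forall>C \<in> components H'. right_star C) \<and> (\<forall>v \<in> verts H. card (left_nbrs H v) \<le> 1))) \<or>
            (((\<forall>C \<in> components H. left_star C) \<and> (\<forall>v \<in> verts H'. card (right_nbrs H' v) \<le> 1)) \<or>
             ((\<forall>C \<in> components H'. left_star C) \<and> (\<forall>v \<in> verts H. card (right_nbrs H v) \<le> 1))) \<or>
            (((\<forall>C \<in> components H. left_star C \<or> right_star C) \<and> (\<forall>C \<in> components H'. monotone_path C)) \<or>
             ((\<forall>C \<in> components H'. left_star C \<or> right_star C) \<and> (\<forall>C \<in> components H. monotone_path C)))))
         \<and> ((\<exists>F \<in> ordered_ramsey H H'. partial_matching F) \<longleftrightarrow>
              partial_matching H \<and> partial_matching H')"
    (is "(_ \<longleftrightarrow> _ \<and> _ \<and> ?cases) \<and> _")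
proof -
  note H = assms(1) and H' = assms(2) and ne = assms(3,4)
  let ?R = "\<exists>F \<in> ordered_ramsey H H'. forest F"
  have comm: "\<exists>F \<in> ordered_ramsey H' H. forest F \<Longrightarrow> ?R"
    using ordered_ramsey_commute[of H H'] by simp
  \<comment> \<open>From here on the cases are expressed by forbidden patterns, the form in which
    both directions were established.\<close>
  have cases_iff: "?cases \<longleftrightarrow> (partial_matching H \<or> partial_matching H') \<or>
    (no_through_vertex H \<and> left_unique H \<and> left_unique H') \<or>
    (no_through_vertex H' \<and> left_unique H' \<and> left_unique H) \<or>
    (no_through_vertex H \<and> right_unique H \<and> right_unique H') \<or>
    (no_through_vertex H' \<and> right_unique H' \<and> right_unique H) \<or>
    (no_through_vertex H \<and> no_zigzag H \<and> left_unique H' \<and> right_unique H') \<or>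
    (no_through_vertex H' \<and> no_zigzag H' \<and> left_unique H \<and> right_unique H)" (is "_ \<longleftrightarrow> ?local")
    unfolding right_star_components_iff[OF H] right_star_components_iff[OF H']
      left_star_components_iff[OF H] left_star_components_iff[OF H']
      star_components_iff[OF H] star_components_iff[OF H']
      monotone_path_components_iff[OF H] monotone_path_components_iff[OF H']
      left_unique_iff_card[OF H, symmetric] left_unique_iff_card[OF H', symmetric]
      right_unique_iff_card[OF H, symmetric] right_unique_iff_card[OF H', symmetric]
    by (simp only: conj_assoc disj_assoc)
  have "?R \<longleftrightarrow> forest H \<and> forest H' \<and> ?local"
  proof
    assume ?R
    then obtain F where F: "F \<in> ordered_ramsey H H'" "forest F" by blast
    then show "forest H \<and> forest H' \<and> ?local"
      using ordered_ramsey_forest_imp_forests[OF H H' ne F]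
        ordered_ramsey_forest_necessary[OF H H' F] by blast
  next
    assume R: "forest H \<and> forest H' \<and> ?local"
    then have F: "forest H" "forest H'" and "?local" by simp_all
    from \<open>?local\<close> show ?R
    proof (elim disjE conjE)
      assume "partial_matching H"
      then show ?R using matching_forest_ramsey[OF H H'] F by blast
    next
      assume "partial_matching H'"
      then show ?R using matching_forest_ramsey[OF H' H] F comm by blast
    next
      assume "no_through_vertex H" "left_unique H" "left_unique H'"
      then show ?R using right_stars_ramsey[OF H H'] by blast
    next
      assume "no_through_vertex H'" "left_unique H'" "left_unique H"
      then show ?R using right_stars_ramsey[OF H' H] comm by blast
    next
      assume "no_through_vertex H" "right_unique H" "right_unique H'"
      then show ?R using left_stars_ramsey[OF H H'] by blast
    next
      assume "no_through_vertex H'" "right_unique H'" "right_unique H"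
      then show ?R using left_stars_ramsey[OF H' H] comm by blast
    next
      assume "no_through_vertex H" "no_zigzag H" "left_unique H'" "right_unique H'"
      then show ?R using stars_monotone_paths_ramsey[OF H H'] by blast
    next
      assume "no_through_vertex H'" "no_zigzag H'" "left_unique H" "right_unique H"
      then show ?R using stars_monotone_paths_ramsey[OF H' H] comm by blast
    qed
  qed
  moreover have "(\<exists>F \<in> ordered_ramsey H H'. partial_matching F) \<longleftrightarrow>
      partial_matching H \<and> partial_matching H'"
  proof
    assume "\<exists>F \<in> ordered_ramsey H H'. partial_matching F"
    then obtain F where F: "F \<in> ordered_ramsey H H'" "partial_matching F" by blast
    then show "partial_matching H \<and> partial_matching H'"
      using ordered_ramsey_monochromatic[OF F(1) ne]
        partial_matching_subgraph_copy[OF F(2) _ H] partial_matching_subgraph_copy[OF F(2) _ H'] by blast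
  qed (use matchings_ramsey[OF H H'] in blast)
  ultimately show ?thesis
    unfolding cases_iff ramsey_density_less_1_iff[OF ne] by blast
qed

end
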